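(* Let $f$ be a convex function with $f(0)=0$ that is strictly increasing on $\mathbb{R}^+$, and for a connected graph $G$ let $\mathrm{W}_f(G)=\sum_{\{u,v\}\subset V(G)} f(d(u,v))$. Let $G$ be a connected graph of order $n$ with matching number $m$. Then $\mathrm{W}_f(G)\le \mathrm{W}_f(\mathcal{A}_{n,m})$, with equality if and only if $G\cong\mathcal{A}_{n,m}$.
   Context: $d(u,v)$ is the graph distance and the sum runs over unordered pairs of distinct vertices. The matching number is the maximum size of a set of pairwise disjoint edges. $\mathcal{A}_{n,m}$ is the tree obtained from a path on $2m-1$ vertices by attaching $\lceil \frac{n-2m+1}{2}\rceil$ new pendent vertices to one end vertex of the path and $\lfloor \frac{n-2m+1}{2}\rfloor$ new pendent vertices to the other end vertex (a balanced double broom; for $n=2m$ it is the path on $2m$ vertices). *)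

theory Defs
  imports "HOL-Analysis.Convex"
begin

text \<open>A finite simple undirected graph is given by its vertex set \<open>V\<close> and its set \<open>E\<close> of edges,
  each edge being a two-element set of vertices.\<close>

definition simple_graph :: "'a set \<Rightarrow> 'a set set \<Rightarrow> bool" where
  "simple_graph V E \<longleftrightarrow> finite V \<and> (\<forall>e\<in>E. e \<subseteq> V \<and> card e = 2)"

definition graph_walk :: "'a set \<Rightarrow> 'a set set \<Rightarrow> 'a list \<Rightarrow> bool" where
  "graph_walk V E xs \<longleftrightarrow> xs \<noteq> [] \<and> set xs \<subseteq> V \<and> successively (\<lambda>u v. {u, v} \<in> E) xs"

definition connected_graph :: "'a set \<Rightarrow> 'a set set \<Rightarrow> bool" where
  "connected_graph V E \<longleftrightarrow> V \<noteq> {} \<and>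
     (\<forall>u\<in>V. \<forall>v\<in>V. \<exists>xs. graph_walk V E xs \<and> hd xs = u \<and> last xs = v)"

text \<open>The length of a walk is its number of edges, one less than the length of its vertex list.
  Only meaningful for vertices joined by a walk.\<close>

definition graph_dist :: "'a set \<Rightarrow> 'a set set \<Rightarrow> 'a \<Rightarrow> 'a \<Rightarrow> nat" where
  "graph_dist V E u v =
     (LEAST k. \<exists>xs. graph_walk V E xs \<and> hd xs = u \<and> last xs = v \<and> length xs = Suc k)"

text \<open>Each unordered pair of distinct vertices occurs as two ordered pairs, hence the division.\<close>

definition wiener_f :: "(real \<Rightarrow> real) \<Rightarrow> 'a set \<Rightarrow> 'a set set \<Rightarrow> real" where
  "wiener_f f V E = (\<Sum>u\<in>V. \<Sum>v\<in>V - {u}. f (real (graph_dist V E u v))) / 2"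

definition graph_matching :: "'a set set \<Rightarrow> 'a set set \<Rightarrow> bool" where
  "graph_matching E M \<longleftrightarrow> M \<subseteq> E \<and> pairwise disjnt M"

definition matching_number :: "'a set set \<Rightarrow> nat" where
  "matching_number E = Max (card ` {M. graph_matching E M})"

definition graph_isomorphic :: "'a set \<Rightarrow> 'a set set \<Rightarrow> 'b set \<Rightarrow> 'b set set \<Rightarrow> bool" where
  "graph_isomorphic V E V' E' \<longleftrightarrow>
     (\<exists>\<phi>. bij_betw \<phi> V V' \<and> (\<forall>u\<in>V. \<forall>v\<in>V. {u, v} \<in> E \<longleftrightarrow> {\<phi> u, \<phi> v} \<in> E'))"

text \<open>The balanced double broom on the vertices \<open>0, \<dots>, n - 1\<close>. The path is
  \<open>0, 1, \<dots>, 2m - 2\<close>; the vertices \<open>2m - 1, \<dots>, n - 1\<close> are pendent, the first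
  \<open>\<lceil>(n - 2m + 1) / 2\<rceil>\<close> of them attached to the end \<open>0\<close> and the remaining
  \<open>\<lfloor>(n - 2m + 1) / 2\<rfloor>\<close> to the end \<open>2m - 2\<close>. For \<open>m \<ge> 1\<close> the condition \<open>i < j\<close> follows
  from the others; it makes the degenerate case \<open>n = 1\<close>, \<open>m = 0\<close> the one-vertex graph.\<close>

definition double_broom_verts :: "nat \<Rightarrow> nat \<Rightarrow> nat set" where
  "double_broom_verts n m = {..<n}"

definition double_broom_edges :: "nat \<Rightarrow> nat \<Rightarrow> nat set set" where
  "double_broom_edges n m =
     (let l = 2 * m - 1; a = nat \<lceil>(real n - 2 * real m + 1) / 2\<rceil> in
      {{i, j} | i j. i < j \<and>
         (j = Suc i \<and> j < l \<or>
          i = 0 \<and> l \<le> j \<and> j < l + a \<or>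
          i = l - 1 \<and> l + a \<le> j \<and> j < n)})"

end

theory Submission
  imports Defs
begin

text \<open>
  Only the values of \<open>f\<close> at positive integers matter, and there it is an increasing convex
  sequence \<open>F\<close>. Passing to a spanning tree increases the distance sum and does not
  increase the matching number. In a tree \<open>T\<close> on \<open>n > 2m\<close> vertices let \<open>u\<close> be a vertex
  farthest from a centroid \<open>c\<close>, and \<open>v\<close> a leaf in another branch at \<open>c\<close>. Every component off
  the path \<open>P\<close> from \<open>u\<close> to \<open>v\<close> has at most \<open>n / 2\<close> vertices, and a component of depth \<open>h\<close>
  contributes \<open>h div 2\<close> edges to a matching that also uses \<open>P\<close>. This bounds the sum of the distances from
  \<open>u\<close> and from \<open>v\<close> by its value for two opposite leaves of a double broom. Since all
  distances \<open>1, \<dots>, e\<close> up to the eccentricity occur, comparison with a chord of \<open>F\<close> turns this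
  into the corresponding bound for \<open>F\<close>, and deleting \<open>u\<close> and \<open>v\<close> gives the upper bound by
  induction; the base is the bound by the path.

  For uniqueness write \<open>F\<close> as a positive multiple of the identity plus an increasing convex sequence, so
  that equality for \<open>F\<close> forces equality for the plain distance sum. There equality makes any
  two leaves of suitable branches at \<open>c\<close> have distance \<open>2m\<close>, with all other vertices
  adjacent to the path between them; hence all of these are attached next to its ends, and the two
  groups of leaves must be balanced.
\<close>

section \<open>Walks and distances\<close>

text \<open>Throughout the induction \<open>m\<close> stays fixed and merely bounds the size of
  matchings, so it survives passing to subgraphs; deleting two leaves corresponds to taking one
  pendent vertex off each end of a broom with an unchanged path. With \<open>n\<close> vertices, two
  opposite leaves of a broom have total distance \<open>2m(n - 1) + 2(n - 1 - 2m)\<close>, their own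
  distance counted once; this is the constant \<open>T\<close>. The centroid makes \<open>T\<close>
  a bound: a matching edge inside a component of at most \<open>n / 2\<close> vertices adds no more
  to the sum than two further path edges would.

  The obstacle is that only the sum over both leaves is controlled, not the share of each. For
  \<open>F\<close> the share is therefore a real parameter, and the chord comparison needs that no
  vertex lies farther from \<open>v\<close> than \<open>u\<close> does, hence the farthest choice of
  \<open>u\<close>. Plain distances need no such choice: the bound holds for every pair of leaves in
  different branches. Equality then speaks about many pairs at once, which is why uniqueness is
  reduced to plain distances.\<close>

definition reach :: "'a set \<Rightarrow> 'a set set \<Rightarrow> nat \<Rightarrow> 'a \<Rightarrow> 'a \<Rightarrow> bool" where
  "reach V E k u v \<longleftrightarrow> (\<exists>xs. graph_walk V E xs \<and> hd xs = u \<and> last xs = v \<and> length xs = Suc k)"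

lemma graph_dist_eq_Least: "graph_dist V E u v = (LEAST k. reach V E k u v)"
  by (simp add: graph_dist_def reach_def)

lemma reach_in: assumes "reach V E k u v" shows "u \<in> V" "v \<in> V"
  using assms unfolding reach_def graph_walk_def by (auto intro: hd_in_set last_in_set)

lemma reach_0: "reach V E 0 u v \<longleftrightarrow> u = v \<and> u \<in> V"
proof
  assume "reach V E 0 u v"
  then obtain xs where "graph_walk V E xs" "hd xs = u" "last xs = v" "length xs = Suc 0"
    by (auto simp: reach_def)
  then show "u = v \<and> u \<in> V" by (cases xs) (auto simp: graph_walk_def)
next
  assume "u = v \<and> u \<in> V"
  then show "reach V E 0 u v" unfolding reach_def graph_walk_def by (intro exI[of _ "[u]"]) auto
qed

lemma reach_Suc: "reach V E (Suc k) u v \<longleftrightarrow> (\<exists>w. reach V E k u w \<and> {w, v} \<in> E \<and> v \<in> V)"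
proof
  assume "reach V E (Suc k) u v"
  then obtain xs where xs: "graph_walk V E xs" "hd xs = u" "last xs = v" "length xs = Suc (Suc k)"
    by (auto simp: reach_def)
  then obtain ys where ys: "xs = ys @ [v]" "length ys = Suc k"
    by (metis append_butlast_last_id diff_Suc_1 length_butlast list.size(3) nat.distinct(1))
  then have "ys \<noteq> []" by auto
  moreover have "graph_walk V E ys" "{last ys, v} \<in> E" "v \<in> V"
    using xs ys \<open>ys \<noteq> []\<close> by (auto simp: graph_walk_def successively_append_iff)
  moreover have "hd ys = u" using xs ys \<open>ys \<noteq> []\<close> by auto
  ultimately show "\<exists>w. reach V E k u w \<and> {w, v} \<in> E \<and> v \<in> V"
    using ys unfolding reach_def by blast
next
  assume "\<exists>w. reach V E k u w \<and> {w, v} \<in> E \<and> v \<in> V"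
  then obtain w ys where "graph_walk V E ys" "hd ys = u" "last ys = w" "length ys = Suc k"
    "{w, v} \<in> E" "v \<in> V" by (auto simp: reach_def)
  then show "reach V E (Suc k) u v" unfolding reach_def graph_walk_def
    by (intro exI[of _ "ys @ [v]"]) (auto simp: successively_append_iff)
qed

lemma reach_trans: "reach V E k u v \<Longrightarrow> reach V E l v w \<Longrightarrow> reach V E (k + l) u w"
  by (induction l arbitrary: w) (auto simp: reach_0 reach_Suc)

lemma reach_edge: "{u, v} \<in> E \<Longrightarrow> u \<in> V \<Longrightarrow> v \<in> V \<Longrightarrow> reach V E 1 u v"
  by (auto simp: reach_0 reach_Suc)

lemma reach_sym: "reach V E k u v \<Longrightarrow> reach V E k v u"
proof (induction k arbitrary: v)
  case (Suc k)
  then obtain w where "reach V E k u w" "{w, v} \<in> E" "v \<in> V" by (auto simp: reach_Suc)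
  then have "w \<in> V" by (blast intro: reach_in)
  then have "reach V E 1 v w" using \<open>{w, v} \<in> E\<close> \<open>v \<in> V\<close> by (intro reach_edge) (simp_all add: insert_commute)
  moreover have "reach V E k w u" using Suc.IH \<open>reach V E k u w\<close> by blast
  ultimately show ?case using reach_trans[of V E 1 v w k u] by simp
qed (auto simp: reach_0)

lemma reach_mono: "reach V E k u v \<Longrightarrow> V \<subseteq> V' \<Longrightarrow> E \<subseteq> E' \<Longrightarrow> reach V' E' k u v"
  by (induction k arbitrary: v) (auto simp: reach_0 reach_Suc)

lemma connected_graph_iff_reach:
  "connected_graph V E \<longleftrightarrow> V \<noteq> {} \<and> (\<forall>u\<in>V. \<forall>v\<in>V. \<exists>k. reach V E k u v)"
proof -
  have "(\<exists>xs. graph_walk V E xs \<and> hd xs = u \<and> last xs = v) \<longleftrightarrow> (\<exists>k. reach V E k u v)" for u v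
  proof
    assume "\<exists>xs. graph_walk V E xs \<and> hd xs = u \<and> last xs = v"
    then obtain xs where xs: "graph_walk V E xs" "hd xs = u" "last xs = v" by auto
    then have "length xs = Suc (length xs - 1)" by (cases xs) (auto simp: graph_walk_def)
    with xs show "\<exists>k. reach V E k u v" unfolding reach_def by blast
  qed (auto simp: reach_def)
  then show ?thesis by (simp add: connected_graph_def)
qed

lemma dist_le_reach: "reach V E k u v \<Longrightarrow> graph_dist V E u v \<le> k"
  by (simp add: graph_dist_eq_Least Least_le)

lemma reach_dist_if: "reach V E k u v \<Longrightarrow> reach V E (graph_dist V E u v) u v"
  unfolding graph_dist_eq_Least by (rule LeastI)

lemma dist_self: "u \<in> V \<Longrightarrow> graph_dist V E u u = 0"
  using dist_le_reach[of V E 0 u u] by (simp add: reach_0)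

lemma dist_sym: "graph_dist V E u v = graph_dist V E v u"
proof -
  have "(\<lambda>k. reach V E k u v) = (\<lambda>k. reach V E k v u)" using reach_sym by (intro ext iffI)
  then show ?thesis by (simp add: graph_dist_eq_Least)
qed

text \<open>Lower bounds on distances come from functions that grow by at most one along every edge;
  layer numbers are the intended instance.\<close>

lemma reach_potential_le:
  fixes pos :: "'a \<Rightarrow> nat"
  assumes "reach V E k u v" and "\<And>x y. x \<in> V \<Longrightarrow> y \<in> V \<Longrightarrow> {x, y} \<in> E \<Longrightarrow> pos y \<le> Suc (pos x)"
  shows "pos v \<le> pos u + k"
  using assms(1)
proof (induction k arbitrary: v)
  case (Suc k)
  then obtain w where "reach V E k u w" "{w, v} \<in> E" "v \<in> V" by (auto simp: reach_Suc)
  moreover have "w \<in> V" using \<open>reach V E k u w\<close> by (blast intro: reach_in)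
  ultimately have "pos v \<le> Suc (pos w)" "pos w \<le> pos u + k" using assms(2) Suc.IH by blast+
  then show ?case by simp
qed (auto simp: reach_0)

section \<open>The distance of a connected graph as a metric\<close>

locale conn_graph =
  fixes V :: "'a set" and E :: "'a set set"
  assumes simple: "simple_graph V E" and conn: "connected_graph V E"
begin

abbreviation d where "d \<equiv> graph_dist V E"

lemma finV [simp]: "finite V" using simple by (simp add: simple_graph_def)

lemma edge_in: assumes "{x, y} \<in> E" shows "x \<in> V" "y \<in> V" "x \<noteq> y"
  using simple assms by (auto simp: simple_graph_def)

lemma nonempty: "V \<noteq> {}" using conn by (simp add: connected_graph_def)

lemma reach_dist: "u \<in> V \<Longrightarrow> v \<in> V \<Longrightarrow> reach V E (d u v) u v"
  using conn reach_dist_if[of V E _ u v] unfolding connected_graph_iff_reach by blast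

lemma dist_eq_0: "u \<in> V \<Longrightarrow> v \<in> V \<Longrightarrow> d u v = 0 \<longleftrightarrow> u = v"
  using reach_dist[of u v] dist_self[of u V E] by (auto simp: reach_0)

lemma dist_pos: "u \<in> V \<Longrightarrow> v \<in> V \<Longrightarrow> u \<noteq> v \<Longrightarrow> 1 \<le> d u v"
  using dist_eq_0[of u v] by simp

lemma dist_triangle: "u \<in> V \<Longrightarrow> v \<in> V \<Longrightarrow> w \<in> V \<Longrightarrow> d u w \<le> d u v + d v w"
  using dist_le_reach[OF reach_trans[OF reach_dist[of u v] reach_dist[of v w]]] by simp

lemma dist_edge: "{u, v} \<in> E \<Longrightarrow> d u v = 1"
  using dist_le_reach[OF reach_edge, of u v E V] edge_in[of u v] dist_pos[of u v] by simp

lemma dist_1: "u \<in> V \<Longrightarrow> v \<in> V \<Longrightarrow> d u v = 1 \<longleftrightarrow> {u, v} \<in> E"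
  using reach_dist[of u v] dist_edge by (auto simp: reach_Suc reach_0)

lemma dist_pred:
  assumes "u \<in> V" "v \<in> V" "d u v = Suc k"
  obtains w where "w \<in> V" "{w, v} \<in> E" "d u w = k"
proof -
  from assms reach_dist[of u v] obtain w where w: "reach V E k u w" "{w, v} \<in> E"
    by (auto simp: reach_Suc)
  then have "d u w \<le> k" "w \<in> V" by (auto intro: dist_le_reach reach_in)
  moreover have "d u v \<le> d u w + 1" using dist_triangle[of u w v] dist_edge[OF w(2)] assms \<open>w \<in> V\<close> by simp
  ultimately show thesis using that[of w] w assms by simp
qed

text \<open>Distances from a fixed vertex leave no gaps, which later allows sums of distances to be
  compared with sums over consecutive integers.\<close>

lemma dist_level:
  assumes "u \<in> V" "v \<in> V" "k \<le> d u v"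
  shows "\<exists>w\<in>V. d u w = k"
  using assms(2,3)
proof (induction "d u v" arbitrary: v)
  case 0 then show ?case by auto
next
  case (Suc l)
  show ?case
  proof (cases "k = d u v")
    case False
    obtain w where "w \<in> V" "d u w = l" using dist_pred[of u v l] assms(1) Suc by metis
    then show ?thesis using Suc False by (metis le_SucE)
  qed (use Suc in auto)
qed

end

text \<open>Ordered pairs are summed, so this is twice the sum over unordered pairs. The weight is
  an arbitrary sequence because the same bound is needed for the identity and for the remainder that
  is left after a linear part is split off.\<close>

definition dist_sum :: "(nat \<Rightarrow> real) \<Rightarrow> 'a set \<Rightarrow> 'a set set \<Rightarrow> real" where
  "dist_sum F V E = (\<Sum>u\<in>V. \<Sum>v\<in>V - {u}. F (graph_dist V E u v))"

lemma dist_antimono: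
  assumes "conn_graph V E" "V \<subseteq> V'" "E \<subseteq> E'" "u \<in> V" "v \<in> V"
  shows "graph_dist V' E' u v \<le> graph_dist V E u v"
  using assms by (intro dist_le_reach reach_mono[OF conn_graph.reach_dist]) auto

lemma dist_sum_antimono:
  assumes "conn_graph V E'" "conn_graph V E" "E' \<subseteq> E" "mono_on {1..} F"
  shows "dist_sum F V E \<le> dist_sum F V E'"
  unfolding dist_sum_def
proof (intro sum_mono)
  fix u v assume "u \<in> V" "v \<in> V - {u}"
  then show "F (graph_dist V E u v) \<le> F (graph_dist V E' u v)"
    using dist_antimono[of V E' V E u v] assms conn_graph.dist_pos[of V E u v]
    by (intro mono_onD[OF assms(4)]) auto
qed

text \<open>The ends of an edge missing from \<open>E'\<close> have distance 1 in one graph and at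
  least 2 in the other, while no distance gets shorter. This identifies an extremal graph with its
  spanning tree.\<close>

lemma spanning_edge_set_eq:
  assumes "conn_graph V E'" "conn_graph V E" "E' \<subseteq> E" "dist_sum real V E = dist_sum real V E'"
  shows "E = E'"
proof (rule ccontr)
  assume "E \<noteq> E'"
  then obtain e where e: "e \<in> E" "e \<notin> E'" using assms(3) by auto
  interpret G: conn_graph V E by fact
  interpret T: conn_graph V E' by fact
  from e G.simple obtain x y where xy: "e = {x, y}" by (auto simp: simple_graph_def card_2_iff)
  have in_V: "x \<in> V" "y \<in> V" "x \<noteq> y" using G.edge_in e xy by auto
  have le: "G.d u v \<le> T.d u v" if "u \<in> V" "v \<in> V" for u v
    using dist_antimono[OF assms(1) subset_refl assms(3) that] .
  have lt: "G.d x y < T.d x y"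
    using G.dist_edge[of x y] e xy T.dist_1[of x y] in_V le[of x y] T.dist_pos[of x y] by auto
  have "dist_sum real V E < dist_sum real V E'" unfolding dist_sum_def
  proof (rule sum_strict_mono_ex1)
    show "\<forall>u\<in>V. (\<Sum>v\<in>V - {u}. real (G.d u v)) \<le> (\<Sum>v\<in>V - {u}. real (T.d u v))"
      using le by (auto intro!: sum_mono)
    have "(\<Sum>v\<in>V - {x}. real (G.d x v)) < (\<Sum>v\<in>V - {x}. real (T.d x v))"
      by (rule sum_strict_mono_ex1) (use le lt in_V in \<open>auto intro!: bexI[of _ y]\<close>)
    then show "\<exists>u\<in>V. (\<Sum>v\<in>V - {u}. real (G.d u v)) < (\<Sum>v\<in>V - {u}. real (T.d u v))"
      using in_V by blast
  qed simp
  with assms(4) show False by simp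
qed

section \<open>Trees\<close>

text \<open>Trees are edge-minimal connected graphs here: a spanning tree is then a minimal element
  of a finite family, and cycles never have to be mentioned.\<close>

definition tree_graph :: "'a set \<Rightarrow> 'a set set \<Rightarrow> bool" where
  "tree_graph V E \<longleftrightarrow> conn_graph V E \<and> (\<forall>E'\<subseteq>E. connected_graph V E' \<longrightarrow> E' = E)"

lemma ex_spanning_tree:
  assumes "conn_graph V E"
  obtains E' where "E' \<subseteq> E" "tree_graph V E'"
proof -
  interpret conn_graph V E by fact
  let ?A = "{E'. E' \<subseteq> E \<and> connected_graph V E'}"
  have "finite E" using simple finV unfolding simple_graph_def
    by (meson Pow_iff finite_Pow_iff finite_subset subsetI)
  then have fin: "finite ?A" by simp
  have ne: "?A \<noteq> {}" using conn by blast
  obtain E' where E': "E' \<in> ?A" "\<forall>E''\<in>?A. E'' \<subseteq> E' \<longrightarrow> E' = E''"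
    using finite_has_minimal[OF fin ne] by (elim bexE) (rule that)
  have "conn_graph V E'"
    using E' simple by unfold_locales (auto simp: simple_graph_def)
  then have "tree_graph V E'" unfolding tree_graph_def using E' by auto
  moreover have "E' \<subseteq> E" using E' by simp
  ultimately show thesis by (intro that)
qed

definition matching_le :: "'a set set \<Rightarrow> nat \<Rightarrow> bool" where
  "matching_le E m \<longleftrightarrow> (\<forall>M. graph_matching E M \<longrightarrow> card M \<le> m)"

text \<open>Every edge leads to a parent and depth is the distance from the root, so paths to the
  root become iterations of \<open>par\<close>. Its value at the root is left open.\<close>

locale rooted_tree = conn_graph V E for V :: "'a set" and E +
  fixes c :: 'a and par :: "'a \<Rightarrow> 'a"
  assumes root_in: "c \<in> V"
    and edges_eq: "E = {{w, par w} | w. w \<in> V - {c}}"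
    and par_in: "w \<in> V \<Longrightarrow> w \<noteq> c \<Longrightarrow> par w \<in> V"
    and depth_par: "w \<in> V \<Longrightarrow> w \<noteq> c \<Longrightarrow> d c w = Suc (d c (par w))"

text \<open>One edge from each vertex to some neighbour nearer to \<open>c\<close> already gives a
  connected graph, so minimality leaves no other edges. Any vertex can be the root; the same tree is
  later rooted at a centroid and at a leaf.\<close>

lemma tree_rooted:
  assumes "tree_graph V E" "c \<in> V"
  obtains par where "rooted_tree V E c par"
proof -
  interpret conn_graph V E using assms by (simp add: tree_graph_def)
  define par where "par w = (SOME x. x \<in> V \<and> {w, x} \<in> E \<and> d c w = Suc (d c x))" for w
  have par: "par w \<in> V \<and> {w, par w} \<in> E \<and> d c w = Suc (d c (par w))" if w: "w \<in> V" "w \<noteq> c" for w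
  proof -
    obtain k where k: "d c w = Suc k" using dist_eq_0[OF assms(2) w(1)] w(2) by (cases "d c w") auto
    then obtain x where "x \<in> V" "{x, w} \<in> E" "d c x = k" using dist_pred[of c w k] w assms by blast
    with k have "\<exists>x. x \<in> V \<and> {w, x} \<in> E \<and> d c w = Suc (d c x)" by (auto simp: insert_commute)
    then show ?thesis unfolding par_def by (rule someI_ex)
  qed
  let ?E' = "{{w, par w} | w. w \<in> V - {c}}"
  have to_root: "reach V ?E' (d c w) w c" if "w \<in> V" for w
    using that
  proof (induction "d c w" arbitrary: w)
    case 0 then show ?case using dist_eq_0[of c w] assms by (simp add: reach_0)
  next
    case (Suc k)
    then have "w \<noteq> c" using dist_self[of c V E] by auto
    with par[of w] Suc have *: "par w \<in> V" "d c (par w) = k" by auto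
    with Suc have "reach V ?E' k (par w) c" by auto
    moreover have "reach V ?E' 1 w (par w)"
      using Suc.prems \<open>w \<noteq> c\<close> * by (intro reach_edge) auto
    ultimately show ?case using Suc(2) reach_trans[of V ?E' 1 w "par w" k c] by simp
  qed
  have "connected_graph V ?E'" unfolding connected_graph_iff_reach
    using reach_trans[OF to_root reach_sym[OF to_root]] nonempty by blast
  moreover have "?E' \<subseteq> E" using par by blast
  ultimately have "?E' = E" using assms(1) by (simp add: tree_graph_def)
  then have "rooted_tree V E c par" using par assms by unfold_locales auto
  then show thesis by (rule that)
qed

lemma level_selection:
  assumes "I \<subseteq> x ` S" obtains S0 where "S0 \<subseteq> S" "bij_betw x S0 I"
  using assms by (metis bij_betw_def subset_image_inj)

text \<open>One vertex on each level and height at most \<open>H\<close> for the others give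
  \<open>H |B| - H (H - 1) / 2\<close>. The stated bound is coarser but linear in
  \<open>H div 2\<close>, the number of matching edges that a chain of \<open>H\<close> vertices
  supplies, so that heights can be traded against matching edges.\<close>

lemma sum_level_bound:
  fixes h :: "'a \<Rightarrow> nat"
  assumes "finite B" "h ` B = {1..H}" "1 \<le> H"
  shows "int (\<Sum>w\<in>B. h w) \<le> int (card B) + int (H div 2) * (2 * int (card B) - 3)"
proof -
  obtain S0 where S0: "S0 \<subseteq> B" "bij_betw h S0 {1..H}" using level_selection[of "{1..H}" h B] assms by blast
  have cS0: "card S0 = H" using bij_betw_same_card[OF S0(2)] by simp
  then have sH: "H \<le> card B" using card_mono[OF assms(1) S0(1)] by simp
  have "(\<Sum>w\<in>S0. h w) = (\<Sum>i=1..H. i)" using sum.reindex_bij_betw[OF S0(2)] by simp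
  also have "\<dots> = H * (H + 1) div 2" using gauss_sum_from_Suc_0[of H, where 'a = nat] by simp
  finally have "2 * (\<Sum>w\<in>S0. h w) = H * (H + 1)" by simp
  moreover have "(\<Sum>w\<in>B - S0. h w) \<le> card (B - S0) * H"
    using sum_bounded_above[of "B - S0" h H] assms(2) by fastforce
  moreover have "card (B - S0) = card B - H" using card_Diff_subset[OF finite_subset[OF S0(1) assms(1)] S0(1)] cS0 by simp
  moreover have "(\<Sum>w\<in>B. h w) = (\<Sum>w\<in>B - S0. h w) + (\<Sum>w\<in>S0. h w)"
    using sum.subset_diff[OF S0(1) assms(1)] .
  ultimately have "2 * (\<Sum>w\<in>B. h w) \<le> H * (H + 1) + 2 * (card B - H) * H" by simp
  then have "int (2 * (\<Sum>w\<in>B. h w)) \<le> int (H * (H + 1) + 2 * (card B - H) * H)"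
    unfolding of_nat_le_iff .
  then have *: "2 * int (\<Sum>w\<in>B. h w) \<le> int H * (int H + 1) + 2 * (int (card B) - int H) * int H"
    unfolding of_nat_add of_nat_mult of_nat_diff[OF sH] by simp
  define \<nu> s where "\<nu> = int (H div 2)" and "s = int (card B)"
  have \<nu>: "\<nu> \<ge> 0" "\<nu> \<le> \<nu> * \<nu>" by (auto simp: \<nu>_def) (metis le_square of_nat_le_iff of_nat_mult)
  have "int H = 2 * \<nu> \<or> int H = 2 * \<nu> + 1" unfolding \<nu>_def by presburger
  then show ?thesis
  proof
    assume H: "int H = 2 * \<nu>"
    then have "s \<ge> 2 * \<nu>" using sH s_def by linarith
    then show ?thesis using * \<nu> unfolding H s_def[symmetric] \<nu>_def[symmetric] by (simp add: algebra_simps)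
  next
    assume H: "int H = 2 * \<nu> + 1"
    then show ?thesis using * \<nu> unfolding H s_def[symmetric] \<nu>_def[symmetric] by (simp add: algebra_simps)
  qed
qed

lemma card_even_interval: "card {k \<in> {1..h}. even k} = h div (2::nat)"
proof (induction h)
  case (Suc h)
  have "{k \<in> {1..Suc h}. even k} = (if even (Suc h) then insert (Suc h) else id) {k \<in> {1..h}. even k}"
    by (auto simp: le_Suc_eq)
  then show ?case using Suc by auto
qed simp

lemma card_odd_atMost: "card {k \<in> {..D}. odd k} = (D + 1) div (2::nat)"
proof (induction D)
  case (Suc D)
  have "{k \<in> {..Suc D}. odd k} = (if odd (Suc D) then insert (Suc D) else id) {k \<in> {..D}. odd k}"
    by (auto simp: le_Suc_eq)
  then show ?case using Suc by auto
qed (auto simp: card_eq_0_iff elim: oddE)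

section \<open>Paths to the root and the matchings they carry\<close>

context rooted_tree
begin

lemma par_edge: "w \<in> V \<Longrightarrow> w \<noteq> c \<Longrightarrow> {w, par w} \<in> E"
  using edges_eq by blast

lemma edgeE:
  assumes "{x, y} \<in> E"
  obtains "x \<in> V" "x \<noteq> c" "y = par x" | "y \<in> V" "y \<noteq> c" "x = par y"
  using assms unfolding edges_eq by (auto simp: doubleton_eq_iff)

lemma depth_iter:
  "w \<in> V \<Longrightarrow> j \<le> d c w \<Longrightarrow> (par ^^ j) w \<in> V \<and> d c ((par ^^ j) w) = d c w - j"
proof (induction j)
  case (Suc j)
  then have *: "(par ^^ j) w \<in> V" "d c ((par ^^ j) w) = d c w - j" by auto
  with Suc have "(par ^^ j) w \<noteq> c" using dist_self[OF root_in] by auto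
  with * show ?case using par_in depth_par[of "(par ^^ j) w"] by simp
qed simp

lemma depth_0: "w \<in> V \<Longrightarrow> d c w = 0 \<longleftrightarrow> w = c"
  using dist_eq_0[of c w] root_in by auto

lemma dist_iter: "w \<in> V \<Longrightarrow> j \<le> d c w \<Longrightarrow> d w ((par ^^ j) w) \<le> j"
proof (induction j)
  case 0 then show ?case using dist_self by simp
next
  case (Suc j)
  then have *: "(par ^^ j) w \<in> V" "d c ((par ^^ j) w) = d c w - j" "(par ^^ Suc j) w \<in> V"
    using depth_iter[of w j] depth_iter[of w "Suc j"] by auto
  with Suc have "(par ^^ j) w \<noteq> c" using dist_self[OF root_in] by auto
  then have "d ((par ^^ j) w) ((par ^^ Suc j) w) = 1" using dist_edge[OF par_edge] * by simp
  then show ?case using dist_triangle[of w "(par ^^ j) w" "(par ^^ Suc j) w"] Suc * by simp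
qed

text \<open>Matchings are given by the lower ends \<open>z\<close> of edges
  \<open>{z, par z}\<close>: these are pairwise disjoint when the parents are distinct and no chosen
  vertex is the parent of another.\<close>

lemma matching_par:
  assumes "matching_le E m"
    and "Z \<subseteq> V - {c}" "inj_on par Z" "Z \<inter> par ` Z = {}"
  shows "card Z \<le> m"
proof -
  let ?e = "\<lambda>z. {z, par z}"
  have disj: "disjnt (?e x) (?e y)" if "x \<in> Z" "y \<in> Z" "x \<noteq> y" for x y
    using that assms(3,4) unfolding disjnt_def inj_on_def by blast
  have "inj_on ?e Z"
  proof (rule inj_onI, rule ccontr)
    fix x y assume "x \<in> Z" "y \<in> Z" "?e x = ?e y" "x \<noteq> y"
    with disj[of x y] show False by (auto simp: disjnt_def)
  qed
  moreover have "graph_matching E (?e ` Z)" unfolding graph_matching_def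
  proof
    show "?e ` Z \<subseteq> E" using assms(2) par_edge by blast
    show "pairwise disjnt (?e ` Z)" using disj unfolding pairwise_def by blast
  qed
  ultimately show ?thesis using assms(1) card_image unfolding matching_le_def by metis
qed

definition anc :: "'a \<Rightarrow> 'a set" where "anc v = (\<lambda>j. (par ^^ j) v) ` {..d c v}"

lemma anc_sub: "v \<in> V \<Longrightarrow> anc v \<subseteq> V" using depth_iter by (auto simp: anc_def)

lemma self_in_anc: "v \<in> anc v" unfolding anc_def by (rule image_eqI[of _ _ 0]) auto

lemma root_in_anc: "v \<in> V \<Longrightarrow> c \<in> anc v"
  using depth_iter[of v "d c v"] depth_0 unfolding anc_def by (metis atMost_iff diff_self_eq_0 image_eqI order_refl)

lemma par_in_anc: "v \<in> V \<Longrightarrow> x \<in> anc v \<Longrightarrow> x \<noteq> c \<Longrightarrow> par x \<in> anc v"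
proof -
  assume v: "v \<in> V" and "x \<in> anc v" and "x \<noteq> c"
  then obtain j where j: "x = (par ^^ j) v" "j \<le> d c v" by (auto simp: anc_def)
  with depth_iter[of v j] v \<open>x \<noteq> c\<close> depth_0[of x] have "Suc j \<le> d c v" by auto
  with j show ?thesis unfolding anc_def by (intro image_eqI[of _ _ "Suc j"]) auto
qed

lemma anc_eqI: "v \<in> V \<Longrightarrow> x \<in> anc v \<Longrightarrow> x = (par ^^ (d c v - d c x)) v \<and> d c x \<le> d c v"
  using depth_iter by (auto simp: anc_def)

lemma inj_depth_anc: "v \<in> V \<Longrightarrow> inj_on (d c) (anc v)"
  using anc_eqI by (metis inj_onI)

lemma depth_image_anc: "v \<in> V \<Longrightarrow> d c ` anc v = {..d c v}"
proof -
  assume v: "v \<in> V"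
  have "k \<in> d c ` anc v" if "k \<le> d c v" for k
    using depth_iter[OF v, of "d c v - k"] that unfolding anc_def by (auto simp: image_image intro!: image_eqI[of _ _ "d c v - k"])
  then show ?thesis using anc_eqI[OF v] by auto
qed

lemma card_anc: "v \<in> V \<Longrightarrow> card (anc v) = Suc (d c v)"
  using card_image[OF inj_depth_anc] depth_image_anc by fastforce

lemma dist_anc: "v \<in> V \<Longrightarrow> x \<in> anc v \<Longrightarrow> d v x \<le> d c v - d c x"
  using dist_iter[of v "d c v - d c x"] anc_eqI[of v x] by fastforce

text \<open>Joining each odd depth on the path to the depth above it gives a matching with half of
  the path's edges, rounded up.\<close>

lemma path_matching:
  assumes "v \<in> V"
  shows "{x \<in> anc v. odd (d c x)} \<subseteq> V - {c}" (is "?Z \<subseteq> _") "inj_on par {x \<in> anc v. odd (d c x)}"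
    "card {x \<in> anc v. odd (d c x)} = (d c v + 1) div 2"
    "x \<in> {x \<in> anc v. odd (d c x)} \<Longrightarrow> par x \<in> anc v \<and> even (d c (par x))"
proof -
  show sub: "?Z \<subseteq> V - {c}" using anc_sub[OF assms] dist_self[OF root_in] by auto
  show "inj_on par ?Z"
  proof (rule inj_onI)
    fix x y assume xy: "x \<in> ?Z" "y \<in> ?Z" "par x = par y"
    then have "d c x = d c y" using depth_par[of x] depth_par[of y] subsetD[OF sub] by auto
    with xy inj_depth_anc[OF assms] show "x = y" by (auto dest: inj_onD)
  qed
  have "card ?Z = card (d c ` ?Z)"
    using card_image[OF inj_on_subset[OF inj_depth_anc[OF assms]], of ?Z] by auto
  also have "d c ` ?Z = {k \<in> {..d c v}. odd k}" using depth_image_anc[OF assms] by auto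
  finally show "card ?Z = (d c v + 1) div 2" using card_odd_atMost[of "d c v"] by simp
  assume "x \<in> ?Z"
  with sub have "x \<in> V" "x \<noteq> c" "x \<in> anc v" "odd (d c x)" by auto
  then show "par x \<in> anc v \<and> even (d c (par x))" using par_in_anc[OF assms, of x] depth_par[of x] by simp
qed

lemma depth_le_matching:
  assumes "matching_le E m" "v \<in> V"
  shows "d c v \<le> 2 * m"
proof -
  have "{x \<in> anc v. odd (d c x)} \<inter> par ` {x \<in> anc v. odd (d c x)} = {}"
    using path_matching(4)[OF assms(2)] by auto
  then have "(d c v + 1) div 2 \<le> m"
    using matching_par[OF assms(1) path_matching(1,2)[OF assms(2)]] path_matching(3)[OF assms(2)] by auto
  then show ?thesis by linarith
qed

end

section \<open>Distances from the two ends of a path\<close>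

text \<open>The arithmetic of the pair bound: \<open>S\<close> is the sum of all heights over the
  path, \<open>e\<close> the number of vertices off it, \<open>a\<close> the contribution of
  matching edges off it and \<open>b\<close> the room for them. It is isolated because the equality
  case must read off that the individual links are tight.\<close>

lemma bound_chain:
  fixes X q :: int
  assumes "X \<le> q + 2 * S - D" "S \<le> e + a" "2 * a \<le> b"
  shows "X \<le> q - D + 2 * e + b"
    and "X = q - D + 2 * e + b \<Longrightarrow> S = e + a" and "X = q - D + 2 * e + b \<Longrightarrow> 2 * a = b"
  using assms by linarith+

context rooted_tree
begin

text \<open>Components off the path from the root to \<open>v\<close> are indexed by their top
  vertex: \<open>ht\<close> counts the steps up to the path and \<open>attach\<close> stops one step
  short of it. The truncated subtraction in \<open>attach\<close> takes effect only on the path,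
  which belongs to no component.\<close>

definition ht :: "'a \<Rightarrow> 'a \<Rightarrow> nat" where "ht v w = (LEAST j. (par ^^ j) w \<in> anc v)"

definition attach :: "'a \<Rightarrow> 'a \<Rightarrow> 'a" where "attach v w = (par ^^ (ht v w - 1)) w"

definition off_comp :: "'a \<Rightarrow> 'a \<Rightarrow> 'a set" where "off_comp v r = {w \<in> V - anc v. attach v w = r}"

definition off_roots :: "'a \<Rightarrow> 'a set" where "off_roots v = attach v ` (V - anc v)"

lemma ht_props:
  assumes "v \<in> V" "w \<in> V"
  shows "(par ^^ ht v w) w \<in> anc v" "ht v w \<le> d c w"
proof -
  have "(par ^^ d c w) w = c" using depth_iter[OF assms(2), of "d c w"] depth_0 by auto
  then have *: "(par ^^ d c w) w \<in> anc v" using root_in_anc[OF assms(1)] by simp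
  then show "(par ^^ ht v w) w \<in> anc v" unfolding ht_def by (rule LeastI)
  show "ht v w \<le> d c w" unfolding ht_def by (rule Least_le) (rule *)
qed

lemma ht_0: "v \<in> V \<Longrightarrow> w \<in> V \<Longrightarrow> ht v w = 0 \<longleftrightarrow> w \<in> anc v"
  using ht_props(1)[of v w] unfolding ht_def by (auto intro: Least_eq_0)

lemma ht_par:
  assumes "v \<in> V" "w \<in> V" "w \<notin> anc v"
  shows "w \<noteq> c" "par w \<in> V" "ht v w = Suc (ht v (par w))"
proof -
  show "w \<noteq> c" using assms root_in_anc by auto
  then show "par w \<in> V" using assms par_in by auto
  have "(par ^^ 0) w \<notin> anc v" using assms by simp
  then have "ht v w = Suc (LEAST j. (par ^^ Suc j) w \<in> anc v)"
    unfolding ht_def using ht_props(1)[OF assms(1,2)] by (intro Least_Suc) auto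
  then show "ht v w = Suc (ht v (par w))" by (simp add: ht_def funpow_swap1)
qed

lemma attach_par:
  assumes "v \<in> V" "w \<in> V" "w \<notin> anc v" "par w \<notin> anc v"
  shows "attach v (par w) = attach v w"
proof -
  note * = ht_par[OF assms(1-3)]
  have "ht v (par w) \<noteq> 0" using ht_0[of v "par w"] * assms by auto
  then obtain k where "ht v (par w) = Suc k" by (cases "ht v (par w)") auto
  then show ?thesis using * by (simp add: attach_def funpow_swap1)
qed

text \<open>Both routes pass through the vertex where the climb from \<open>w\<close> meets the
  path: the two pieces of the path add up to its length, and the climb is counted twice.\<close>

lemma dist_sum_pair_le:
  assumes "v \<in> V" "w \<in> V"
  shows "d c w + d v w \<le> d c v + 2 * ht v w"
proof -
  let ?p = "(par ^^ ht v w) w"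
  note * = ht_props[OF assms]
  have p: "?p \<in> V" "d c ?p = d c w - ht v w" using depth_iter[OF assms(2) *(2)] by auto
  have "d v w \<le> d v ?p + d ?p w" using dist_triangle assms p by blast
  moreover have "d ?p w \<le> ht v w" using dist_iter[OF assms(2) *(2)] dist_sym[of V E w ?p] by simp
  moreover have "d v ?p \<le> d c v - d c ?p" "d c ?p \<le> d c v"
    using dist_anc[OF assms(1) *(1)] anc_eqI[OF assms(1) *(1)] by auto
  ultimately show ?thesis using p(2) *(2) by linarith
qed

lemma ht_iter:
  assumes "v \<in> V" "w \<in> V" "j < ht v w"
  shows "(par ^^ j) w \<in> V - anc v \<and> ht v ((par ^^ j) w) = ht v w - j \<and> attach v ((par ^^ j) w) = attach v w"
  using assms(3)
proof (induction j)
  case 0 then show ?case using assms ht_0[of v w] by auto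
next
  case (Suc j)
  let ?x = "(par ^^ j) w"
  have x: "?x \<in> V" "?x \<notin> anc v" "ht v ?x = ht v w - j" "attach v ?x = attach v w" using Suc by auto
  note * = ht_par[OF assms(1) x(1,2)]
  have "ht v (par ?x) = ht v w - Suc j" using * x Suc.prems by simp
  moreover from this Suc.prems have "par ?x \<notin> anc v" using ht_0[OF assms(1) *(2)] by auto
  ultimately show ?case using * attach_par[OF assms(1) x(1,2)] x by simp
qed

text \<open>The chains from the path to a deepest vertex of each component off the path are disjoint from
  the path and from each other, so their maximum matchings add up.\<close>

lemma off_path_matching:
  assumes match: "matching_le E m" and v: "v \<in> V"
  shows "(d c v + 1) div 2 + (\<Sum>r\<in>off_roots v. Max (ht v ` off_comp v r) div 2) \<le> m" (is ?sum)
    and "r \<in> off_roots v \<Longrightarrow> ht v ` off_comp v r = {1..Max (ht v ` off_comp v r)} \<and>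
      1 \<le> Max (ht v ` off_comp v r)"
proof -
  define R where "R = off_roots v"
  define B where "B = off_comp v"
  note B_def = B_def off_comp_def and R_def = R_def off_roots_def
  let ?P = "anc v"
  define H where "H r = Max (ht v ` B r)" for r
  have finB: "finite (B r)" for r by (simp add: B_def)
  have Bne: "B r \<noteq> {}" if "r \<in> R" for r using that by (auto simp: R_def B_def)
  define W where "W r = (SOME w. w \<in> B r \<and> ht v w = H r)" for r
  have W: "W r \<in> B r \<and> ht v (W r) = H r" if "r \<in> R" for r
  proof -
    have "H r \<in> ht v ` B r" unfolding H_def using Bne[OF that] finB by (intro Max_in) auto
    then have "\<exists>w. w \<in> B r \<and> ht v w = H r" by auto
    then show ?thesis unfolding W_def by (rule someI_ex)
  qed
  define C where "C = {(r, j). r \<in> R \<and> j < H r}"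
  \<comment> \<open>\<open>q (r, j)\<close> is the \<open>j\<close>-th ancestor of a deepest vertex
    of component \<open>r\<close>, hence has height \<open>H r - j\<close>.\<close>
  define q where "q = (\<lambda>(r, j). (par ^^ j) (W r))"
  have q: "q (r, j) \<in> V - ?P" "ht v (q (r, j)) = H r - j" "attach v (q (r, j)) = r"
    if "r \<in> R" "j < H r" for r j
    using ht_iter[OF v, of "W r" j] W[OF that(1)] that(2) by (auto simp: q_def B_def)
  show "ht v ` off_comp v r = {1..Max (ht v ` off_comp v r)} \<and> 1 \<le> Max (ht v ` off_comp v r)"
    if "r \<in> off_roots v"
  proof -
    have r: "r \<in> R" using that by (simp add: R_def)
    have pos: "1 \<le> ht v w" if "w \<in> B r" for w using that ht_0[OF v, of w] by (auto simp: B_def)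
    have "k \<in> ht v ` B r" if "1 \<le> k" "k \<le> H r" for k
      using q[OF r, of "H r - k"] that by (intro image_eqI[of _ _ "q (r, H r - k)"]) (auto simp: B_def)
    moreover have "ht v w \<le> H r" if "w \<in> B r" for w unfolding H_def using that finB by simp
    moreover have "1 \<le> H r" using pos[of "W r"] W[OF r] by simp
    ultimately show ?thesis using pos unfolding B_def(1)[symmetric] H_def[symmetric] by auto
  qed
  define Z1 where "Z1 = {x \<in> ?P. odd (d c x)}"
  \<comment> \<open>Even heights are matched with the odd height below them. The lowest such edge
    joins heights 2 and 1, so the path itself is never touched.\<close>
  define J where "J r = {j. j < H r \<and> even (H r - j)}" for r
  define Z2 where "Z2 = q ` (SIGMA r:R. J r)"
  have injq: "inj_on q (SIGMA r:R. J r)"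
  proof (rule inj_onI)
    fix a b assume ab: "a \<in> (SIGMA r:R. J r)" "b \<in> (SIGMA r:R. J r)" "q a = q b"
    obtain r j s k where e: "a = (r, j)" "b = (s, k)" by (cases a, cases b) auto
    with ab have "r \<in> R" "j < H r" "s \<in> R" "k < H s" by (auto simp: J_def)
    with ab e q[of r j] q[of s k] show "a = b" by auto
  qed
  have finR: "finite R" by (simp add: R_def)
  have cJ: "card (J r) = H r div 2" for r
  proof -
    have "bij_betw (\<lambda>j. H r - j) (J r) {k \<in> {1..H r}. even k}"
      by (rule bij_betwI[where g = "\<lambda>k. H r - k"]) (auto simp: J_def)
    then show ?thesis using bij_betw_same_card card_even_interval by metis
  qed
  have cZ2: "card Z2 = (\<Sum>r\<in>R. H r div 2)"
    unfolding Z2_def card_image[OF injq] using finR cJ by (subst card_SigmaI) (auto simp: J_def)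
  have Z2: "x \<in> V - ?P" "even (ht v x)" "par x \<in> V - ?P" "odd (ht v (par x))"
    "attach v (par x) = attach v x" if "x \<in> Z2" for x
  proof -
    from that obtain r j where rj: "x = q (r, j)" "r \<in> R" "j < H r" "even (H r - j)"
      by (auto simp: Z2_def J_def)
    with q[of r j] show x: "x \<in> V - ?P" "even (ht v x)" by auto
    note * = ht_par[OF v, of x]
    have "ht v x = Suc (ht v (par x))" "par x \<in> V" using * x by auto
    moreover from this x have odd: "odd (ht v (par x))" by simp
    moreover have "par x \<notin> ?P" using ht_0[OF v \<open>par x \<in> V\<close>] odd by (metis even_zero)
    ultimately show "par x \<in> V - ?P" "odd (ht v (par x))" "attach v (par x) = attach v x"
      using attach_par[OF v, of x] x by auto
  qed
  have inj2: "inj_on par Z2"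
  proof (rule inj_onI)
    fix x y assume xy: "x \<in> Z2" "y \<in> Z2" "par x = par y"
    have "ht v x = ht v y" using ht_par(3)[OF v, of x] ht_par(3)[OF v, of y] Z2(1) xy by auto
    moreover have "attach v x = attach v y" using Z2(5) xy by metis
    moreover obtain r j where rj: "x = q (r, j)" "r \<in> R" "j < H r"
      using xy by (auto simp: Z2_def J_def)
    moreover obtain s k where sk: "y = q (s, k)" "s \<in> R" "k < H s"
      using xy by (auto simp: Z2_def J_def)
    ultimately have "r = s" "H r - j = H s - k" using q[of r j] q[of s k] by simp_all
    then have "j = k" using rj sk by simp
    with \<open>r = s\<close> show "x = y" using rj sk by simp
  qed
  note pm = path_matching[OF v, folded Z1_def]
  have "card (Z1 \<union> Z2) \<le> m"
  proof (rule matching_par[OF match])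
    show "Z1 \<union> Z2 \<subseteq> V - {c}" using pm(1) Z2(1) root_in_anc[OF v] by auto
    show "inj_on par (Z1 \<union> Z2)"
    proof (rule inj_onI)
      fix x y assume "x \<in> Z1 \<union> Z2" "y \<in> Z1 \<union> Z2" "par x = par y"
      moreover have "par x \<in> ?P" if "x \<in> Z1" for x using pm(4)[OF that] by blast
      moreover have "par x \<notin> ?P" if "x \<in> Z2" for x using Z2(3)[OF that] by blast
      ultimately show "x = y" using inj_onD[OF pm(2), of x y] inj_onD[OF inj2, of x y] by (metis UnE)
    qed
    show "(Z1 \<union> Z2) \<inter> par ` (Z1 \<union> Z2) = {}"
    proof -
      have "par x \<notin> Z1 \<union> Z2" if "x \<in> Z1" for x
        using pm(4)[OF that] Z2(1)[of "par x"] by (auto simp: Z1_def)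
      moreover have "par x \<notin> Z1 \<union> Z2" if "x \<in> Z2" for x
        using Z2(3,4)[OF that] Z2(2)[of "par x"] by (auto simp: Z1_def)
      ultimately show ?thesis by blast
    qed
  qed
  moreover have "Z1 \<inter> Z2 = {}" using Z2(1) by (auto simp: Z1_def)
  moreover have "finite Z1" "finite Z2"
    using pm(1) Z2(1) finite_subset[OF _ finV, of Z1] finite_subset[OF _ finV, of Z2] by auto
  ultimately show ?sum
    using pm(3) cZ2 unfolding H_def B_def(1) R_def(1) by (simp add: card_Un_disjoint)
qed

text \<open>In \<open>X\<close>, a matching edge inside a component with at most half of the
  \<open>n\<close> vertices is worth at most \<open>2 (n - 3)\<close>, which is also the worth of
  two more path edges; \<open>T\<close> is the value when the path has length \<open>2 * m\<close>.
  If all components are strictly smaller than half, such an edge is a real loss, and equality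
  confines all vertices to height at most 1.\<close>

lemma pair_distance_bound:
  fixes br :: "'a \<Rightarrow> 'a"
  assumes match: "matching_le E m" and v: "v \<in> V" and n3: "3 \<le> card V"
    and br: "\<And>x y. {x, y} \<in> E \<Longrightarrow> x \<notin> anc v \<Longrightarrow> y \<notin> anc v \<Longrightarrow> br x = br y"
    and size: "\<And>t. 2 * card {w \<in> V - anc v. br w = t} \<le> card V"
  defines "X \<equiv> int (\<Sum>w\<in>V. d c w) + int (\<Sum>w\<in>V. d v w) - int (d c v)"
    and "T \<equiv> 2 * int m * (int (card V) - 1) + 2 * (int (card V) - 1 - 2 * int m)"
  shows "X \<le> T"
    and "(\<And>t. 2 * card {w \<in> V - anc v. br w = t} < card V) \<Longrightarrow> X = T \<Longrightarrow> 2 \<le> d c v \<Longrightarrow>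
      2 * m + 1 \<le> card V \<Longrightarrow> d c v = 2 * m \<and> (\<forall>w\<in>V. ht v w \<le> 1)"
proof -
  let ?P = "anc v"
  define n D where "n = int (card V)" and "D = int (d c v)"
  define B where "B = off_comp v"
  define R where "R = off_roots v"
  define nu where "nu r = int (Max (ht v ` B r) div 2)" for r
  note om = off_path_matching[OF match v, folded B_def R_def]
  note B_def = B_def off_comp_def and R_def = R_def off_roots_def
  have finR: "finite R" by (simp add: R_def)
  have finB: "finite (B r)" for r by (simp add: B_def)
  \<comment> \<open>Climbing inside a component does not change \<open>br\<close>, so each component
    lies in one fibre and inherits its size bound.\<close>
  have Bsub: "B r \<subseteq> {w \<in> V - ?P. br w = br r}" for r
  proof -
    have "br w = br (attach v w)" if "w \<in> V - ?P" for w
      using that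
    proof (induction "ht v w" arbitrary: w)
      case 0 then show ?case using ht_0[OF v, of w] by auto
    next
      case (Suc k)
      note * = ht_par[OF v, of w]
      show ?case
      proof (cases "par w \<in> ?P")
        case True
        then have "ht v (par w) = 0" using ht_0[OF v, of "par w"] * Suc.prems by auto
        then have "ht v w = 1" using * Suc.prems by auto
        then show ?thesis by (simp add: attach_def)
      next
        case False
        then have "br (par w) = br (attach v (par w))" using Suc * by auto
        then show ?thesis using attach_par[OF v, of w] False Suc.prems br[of w "par w"] par_edge[of w] * by auto
      qed
    qed
    then show ?thesis by (auto simp: B_def)
  qed
  have size_B: "2 * int (card (B r)) \<le> n" for r
    using card_mono[OF _ Bsub[of r]] size[of "br r"] finV unfolding n_def by fastforce
  have nu0: "0 \<le> nu r" for r by (simp add: nu_def)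
  have sumB: "int (\<Sum>w\<in>B r. ht v w) \<le> int (card (B r)) + nu r * (2 * int (card (B r)) - 3)" if "r \<in> R" for r
    unfolding nu_def using sum_level_bound[OF finB, of "ht v" r] om(2)[OF that] by blast
  have sumB': "int (\<Sum>w\<in>B r. ht v w) \<le> int (card (B r)) + nu r * (n - 3)" if "r \<in> R" for r
  proof -
    have "nu r * (2 * int (card (B r)) - 3) \<le> nu r * (n - 3)"
      using size_B[of r] nu0 by (intro mult_left_mono) auto
    then show ?thesis using sumB[OF that] by linarith
  qed
  have split: "sum g (V - ?P) = (\<Sum>r\<in>R. sum g (B r))" for g :: "'a \<Rightarrow> int"
    unfolding B_def R_def by (rule sum.image_gen) simp
  have cardP: "int (card (V - ?P)) = n - 1 - D"
    using card_Diff_subset[OF finite_subset[OF anc_sub[OF v] finV] anc_sub[OF v]] card_anc[OF v]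
      card_mono[OF finV anc_sub[OF v]] unfolding n_def D_def by simp
  have cardsum: "(\<Sum>r\<in>R. int (card (B r))) = n - 1 - D"
    using split[of "\<lambda>_. 1"] cardP by simp
  have nusum: "2 * (\<Sum>r\<in>R. nu r) \<le> 2 * int m - D"
  proof -
    have "int ((d c v + 1) div 2 + (\<Sum>r\<in>R. Max (ht v ` B r) div 2)) \<le> int m"
      using om(1) unfolding of_nat_le_iff .
    then have "int ((d c v + 1) div 2) + (\<Sum>r\<in>R. nu r) \<le> int m" by (simp add: nu_def)
    then show ?thesis unfolding D_def by linarith
  qed
  have htV: "int (\<Sum>w\<in>V. ht v w) = (\<Sum>r\<in>R. int (\<Sum>w\<in>B r. ht v w))"
  proof -
    have "(\<Sum>w\<in>?P. ht v w) = 0" using ht_0[OF v] anc_sub[OF v] by (auto simp: sum_eq_0_iff finite_subset[OF _ finV])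
    then have "(\<Sum>w\<in>V. ht v w) = (\<Sum>w\<in>V - ?P. ht v w)" using sum.subset_diff[OF anc_sub[OF v] finV, of "ht v"] by simp
    then show ?thesis using split[of "\<lambda>w. int (ht v w)"] by simp
  qed
  have n3': "0 \<le> n - 3" using n3 by (simp add: n_def)
  have "(\<Sum>w\<in>V. d c w) + (\<Sum>w\<in>V. d v w) \<le> (\<Sum>w\<in>V. d c v + 2 * ht v w)"
    unfolding sum.distrib[symmetric] by (intro sum_mono dist_sum_pair_le v)
  then have "(\<Sum>w\<in>V. d c w) + (\<Sum>w\<in>V. d v w) \<le> card V * d c v + 2 * (\<Sum>w\<in>V. ht v w)"
    by (simp add: sum.distrib sum_distrib_left)
  then have "int ((\<Sum>w\<in>V. d c w) + (\<Sum>w\<in>V. d v w)) \<le> int (card V * d c v + 2 * (\<Sum>w\<in>V. ht v w))"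
    unfolding of_nat_le_iff .
  then have X1: "X \<le> n * D + 2 * int (\<Sum>w\<in>V. ht v w) - D" unfolding X_def n_def D_def of_nat_add of_nat_mult by simp
  \<comment> \<open>\<open>T\<close> is rewritten around the actual path length \<open>D\<close>,
    with the slack \<open>2 * m - D\<close> as the factor that pays for matching edges off the
    path.\<close>
  have Teq: "T = n * D - D + 2 * ((n - 1 - D)) + (2 * int m - D) * (n - 3)"
    unfolding T_def n_def[symmetric] by (simp add: algebra_simps)
  have h2: "(\<Sum>r\<in>R. int (card (B r)) + nu r * (n - 3)) = (n - 1 - D) + (\<Sum>r\<in>R. nu r) * (n - 3)"
    by (simp add: sum.distrib cardsum sum_distrib_right)
  have h3: "2 * ((\<Sum>r\<in>R. nu r) * (n - 3)) \<le> (2 * int m - D) * (n - 3)"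
    using mult_right_mono[OF nusum n3'] by (simp add: mult.assoc)
  have h1: "int (\<Sum>w\<in>V. ht v w) \<le> (n - 1 - D) + (\<Sum>r\<in>R. nu r) * (n - 3)"
    unfolding htV h2[symmetric] by (rule sum_mono) (rule sumB')
  note lin = bound_chain[OF X1 h1 h3]
  show "X \<le> T" using lin(1) unfolding Teq .
  assume strict: "\<And>t. 2 * card {w \<in> V - anc v. br w = t} < card V" and "X = T"
    and D2: "2 \<le> d c v" and m_le: "2 * m + 1 \<le> card V"
  note eq = lin(2,3)[OF \<open>X = T\<close>[unfolded Teq]]
  have nu_0: "nu r = 0" if r: "r \<in> R" for r
  proof (rule ccontr)
    assume "nu r \<noteq> 0"
    then have "0 < nu r" using nu0[of r] by simp
    moreover have "2 * int (card (B r)) < n"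
      using card_mono[OF _ Bsub[of r]] strict[of "br r"] finV unfolding n_def by fastforce
    ultimately have "nu r * (2 * int (card (B r)) - 3) < nu r * (n - 3)" by simp
    then have "int (\<Sum>w\<in>B r. ht v w) < int (card (B r)) + nu r * (n - 3)" using sumB[OF r] by linarith
    then have "(\<Sum>r\<in>R. int (\<Sum>w\<in>B r. ht v w)) < (\<Sum>r\<in>R. int (card (B r)) + nu r * (n - 3))"
      using sumB' r by (intro sum_strict_mono_ex1[OF finR]) auto
    then show False using eq(1) unfolding htV h2 by simp
  qed
  then have "(2 * int m - D) * (n - 3) = 0" using eq(2) by simp
  moreover have "D \<le> 2 * int m" using depth_le_matching[OF match v] unfolding D_def by simp
  \<comment> \<open>The factor \<open>n - 3\<close> may vanish; then
    \<open>2 * m + 1 \<le> 3\<close> and \<open>2 \<le> D \<le> 2 * m\<close> still force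
    \<open>D = 2 * m\<close>.\<close>
  ultimately have "d c v = 2 * m"
    using D2 m_le unfolding D_def n_def by auto
  moreover have "ht v w \<le> 1" if "w \<in> V" for w
  proof (cases "w \<in> ?P")
    case False
    then have r: "attach v w \<in> R" "w \<in> B (attach v w)" using that by (auto simp: R_def B_def)
    then have "ht v w \<le> Max (ht v ` B (attach v w))" using finB by simp
    moreover have "Max (ht v ` B (attach v w)) div 2 = 0" using nu_0[OF r(1)] by (simp add: nu_def)
    ultimately show ?thesis by simp
  qed (use ht_0[OF v that] in simp)
  ultimately show "d c v = 2 * m \<and> (\<forall>w\<in>V. ht v w \<le> 1)" by blast
qed

end

section \<open>Deleting leaves\<close>

lemma matching_le_subset: "matching_le E m \<Longrightarrow> E' \<subseteq> E \<Longrightarrow> matching_le E' m"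
  unfolding matching_le_def graph_matching_def by (meson subset_trans)

lemma double_sum_remove:
  fixes g :: "'a \<Rightarrow> 'a \<Rightarrow> real"
  assumes "finite V" "z \<in> V" "\<And>x y. g x y = g y x"
  shows "(\<Sum>u\<in>V. \<Sum>v\<in>V - {u}. g u v) =
    (\<Sum>u\<in>V - {z}. \<Sum>v\<in>V - {z} - {u}. g u v) + 2 * (\<Sum>w\<in>V - {z}. g z w)"
proof -
  have "(\<Sum>v\<in>V - {u}. g u v) = g z u + (\<Sum>v\<in>V - {z} - {u}. g u v)" if "u \<in> V - {z}" for u
  proof -
    have "V - {u} = insert z (V - {z} - {u})" using that assms by auto
    then show ?thesis using assms by simp
  qed
  then have "(\<Sum>u\<in>V - {z}. \<Sum>v\<in>V - {u}. g u v) =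
      (\<Sum>w\<in>V - {z}. g z w) + (\<Sum>u\<in>V - {z}. \<Sum>v\<in>V - {z} - {u}. g u v)"
    by (simp add: sum.distrib)
  then show ?thesis using sum.remove[OF assms(1,2), of "\<lambda>u. \<Sum>v\<in>V - {u}. g u v"] by simp
qed

lemma dist_sum_subgraph_le:
  assumes "conn_graph V E" "conn_graph V' E'" "V' \<subseteq> V" "E' \<subseteq> E" "mono_on {1..} F"
  shows "(\<Sum>u\<in>V'. \<Sum>v\<in>V' - {u}. F (graph_dist V E u v)) \<le> dist_sum F V' E'"
  unfolding dist_sum_def
proof (intro sum_mono)
  fix u v assume "u \<in> V'" "v \<in> V' - {u}"
  then show "F (graph_dist V E u v) \<le> F (graph_dist V' E' u v)"
    using dist_antimono[of V' E' V E u v] assms conn_graph.dist_pos[of V E u v] conn_graph.dist_pos[of V' E' u v]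
    by (intro mono_onD[OF assms(5)]) auto
qed

lemma dist_sum_delete:
  assumes "conn_graph V E" "conn_graph (V - {u}) E'" "E' \<subseteq> E" "mono_on {1..} F" "u \<in> V"
  shows "dist_sum F V E \<le> dist_sum F (V - {u}) E' + 2 * (\<Sum>w\<in>V - {u}. F (graph_dist V E u w))"
proof -
  have "finite V" using conn_graph.finV[OF assms(1)] .
  then have "dist_sum F V E = (\<Sum>x\<in>V - {u}. \<Sum>y\<in>V - {u} - {x}. F (graph_dist V E x y)) +
      2 * (\<Sum>w\<in>V - {u}. F (graph_dist V E u w))"
    unfolding dist_sum_def using assms(5)
    by (intro double_sum_remove) (auto simp: dist_sym)
  then show ?thesis using dist_sum_subgraph_le[OF assms(1,2) _ assms(3,4)] by auto
qed

lemma dist_sum_delete2: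
  assumes "conn_graph V E" "conn_graph (V - {u, v}) E'" "E' \<subseteq> E" "mono_on {1..} F"
    "u \<in> V" "v \<in> V" "u \<noteq> v"
  shows "dist_sum F V E \<le> dist_sum F (V - {u, v}) E' +
    2 * ((\<Sum>w\<in>V - {u}. F (graph_dist V E u w)) + (\<Sum>w\<in>V - {u, v}. F (graph_dist V E v w)))"
proof -
  have fin: "finite V" using conn_graph.finV[OF assms(1)] .
  have eq: "V - {u} - {v} = V - {u, v}" by auto
  have "dist_sum F V E = (\<Sum>x\<in>V - {u}. \<Sum>y\<in>V - {u} - {x}. F (graph_dist V E x y)) +
      2 * (\<Sum>w\<in>V - {u}. F (graph_dist V E u w))"
    unfolding dist_sum_def using assms fin
    by (intro double_sum_remove) (auto simp: dist_sym)
  also have "(\<Sum>x\<in>V - {u}. \<Sum>y\<in>V - {u} - {x}. F (graph_dist V E x y)) =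
      (\<Sum>x\<in>V - {u} - {v}. \<Sum>y\<in>V - {u} - {v} - {x}. F (graph_dist V E x y)) +
      2 * (\<Sum>w\<in>V - {u} - {v}. F (graph_dist V E v w))"
    using assms fin by (intro double_sum_remove) (auto simp: dist_sym)
  finally show ?thesis using dist_sum_subgraph_le[OF assms(1,2) _ assms(3,4)] unfolding eq by auto
qed

context rooted_tree
begin

lemma delete_leaves:
  assumes "Z \<subseteq> V - {c}" "Z \<inter> par ` (V - {c}) = {}"
  shows "conn_graph (V - Z) {e \<in> E. e \<inter> Z = {}}"
proof -
  let ?V = "V - Z" and ?E = "{e \<in> E. e \<inter> Z = {}}"
  have to_root: "reach ?V ?E (d c w) w c" if "w \<in> ?V" for w
    using that
  proof (induction "d c w" arbitrary: w)
    case 0 then show ?case using depth_0[of w] by (auto simp: reach_0)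
  next
    case (Suc k)
    then have w: "w \<noteq> c" "w \<in> V" "w \<notin> Z" using dist_self[OF root_in] by auto
    then have p: "par w \<in> ?V" "d c (par w) = k" using Suc(2) par_in depth_par[of w] assms by auto
    then have "reach ?V ?E k (par w) c" using Suc(1)[of "par w"] by auto
    moreover have "reach ?V ?E 1 w (par w)" using w p par_edge[of w] by (intro reach_edge) auto
    ultimately show ?case using Suc(2) reach_trans[of ?V ?E 1 w "par w" k c] by simp
  qed
  have "connected_graph ?V ?E" unfolding connected_graph_iff_reach
    using reach_trans[OF to_root reach_sym[OF to_root]] root_in assms by blast
  moreover have "simple_graph ?V ?E" using simple by (auto simp: simple_graph_def)
  ultimately show ?thesis by unfold_locales
qed

text \<open>A vertex without children. The root is excluded even if its degree is one, so deleting
  leaves always keeps the root.\<close>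

definition leaf :: "'a \<Rightarrow> bool" where
  "leaf z \<longleftrightarrow> z \<in> V \<and> z \<noteq> c \<and> z \<notin> par ` (V - {c})"

lemma leaf_neighbour: "leaf z \<Longrightarrow> {z, y} \<in> E \<Longrightarrow> y = par z"
  by (erule edgeE[of z y]) (auto simp: leaf_def)

text \<open>A deepest vertex of a set closed under children has no child. The set is either
  everything but the root, giving a farthest leaf, or one branch.\<close>

lemma ex_leaf_max:
  assumes "S \<subseteq> V - {c}" "S \<noteq> {}" "\<And>w. w \<in> V - {c} \<Longrightarrow> par w \<in> S \<Longrightarrow> w \<in> S"
  obtains z where "z \<in> S" "leaf z" "\<forall>w\<in>S. d c w \<le> d c z"
proof -
  have fin: "finite S" using assms(1) finV finite_subset by blast
  then have "Max (d c ` S) \<in> d c ` S" using assms by (intro Max_in) auto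
  then obtain z where z: "z \<in> S" "d c z = Max (d c ` S)" by auto
  have max: "d c w \<le> d c z" if "w \<in> S" for w using that fin z by simp
  have "z \<notin> par ` (V - {c})"
  proof
    assume "z \<in> par ` (V - {c})"
    then obtain w where "w \<in> V - {c}" "z = par w" by auto
    with z assms(3) max[of w] depth_par[of w] show False by auto
  qed
  with z assms(1) have "leaf z" by (auto simp: leaf_def)
  with z max that show thesis by blast
qed

end

text \<open>The ordered distance sum of the path on \<open>n\<close> vertices: appending a vertex to
  a path on \<open>k\<close> vertices creates the distances \<open>1, ..., k\<close>.\<close>

definition path_sum :: "(nat \<Rightarrow> real) \<Rightarrow> nat \<Rightarrow> real" where
  "path_sum F n = 2 * (\<Sum>k<n. \<Sum>i=1..k. F i)"

text \<open>Since the values have no gaps, one element can be set aside for each of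
  \<open>1, ..., e\<close>; every other element contributes at most \<open>F e\<close>, and the
  indices above \<open>e\<close> that replace it on the right contribute at least that.\<close>

lemma sum_levels_le:
  fixes F :: "nat \<Rightarrow> real"
  assumes "finite S" "x ` S = {1..e}" "mono_on {1..} F"
  shows "(\<Sum>w\<in>S. F (x w)) \<le> (\<Sum>i=1..card S. F i)"
    and "e < card S \<Longrightarrow> strict_mono_on {1..} F \<Longrightarrow> (\<Sum>w\<in>S. F (x w)) < (\<Sum>i=1..card S. F i)"
proof -
  obtain S0 where S0: "S0 \<subseteq> S" "bij_betw x S0 {1..e}" using level_selection[of "{1..e}" x S] assms by blast
  have cS0: "card S0 = e" using bij_betw_same_card[OF S0(2)] by simp
  then have eS: "e \<le> card S" using card_mono[OF assms(1) S0(1)] by simp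
  have 1: "(\<Sum>w\<in>S0. F (x w)) = (\<Sum>i=1..e. F i)" using sum.reindex_bij_betw[OF S0(2)] by simp
  have rest: "1 \<le> x w \<and> x w \<le> e" if "w \<in> S" for w
    using imageI[OF that, of x] unfolding assms(2) by simp
  have 2: "(\<Sum>w\<in>S - S0. F (x w)) \<le> (\<Sum>w\<in>S - S0. F e)"
    using rest by (intro sum_mono mono_onD[OF assms(3)]) force+
  have card: "card (S - S0) = card S - e"
    using card_Diff_subset[OF finite_subset[OF S0(1) assms(1)] S0(1)] cS0 by simp
  have split: "(\<Sum>w\<in>S. F (x w)) = (\<Sum>w\<in>S - S0. F (x w)) + (\<Sum>i=1..e. F i)"
    using sum.subset_diff[OF S0(1) assms(1), of "\<lambda>w. F (x w)"] 1 by simp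
  have upper: "(\<Sum>i=1..card S. F i) = (\<Sum>i=1..e. F i) + (\<Sum>i\<in>{e<..card S}. F i)"
    using eS by (subst sum.union_disjoint[symmetric]) (auto intro!: sum.cong)
  have e1: "1 \<le> e" if "e < card S"
  proof -
    have "S \<noteq> {}" using that by auto
    then show ?thesis using rest by (meson all_not_in_conv le_trans)
  qed
  have "(\<Sum>w\<in>S - S0. F e) = (\<Sum>i\<in>{e<..card S}. F e)" using card by simp
  also have "\<dots> \<le> (\<Sum>i\<in>{e<..card S}. F i)"
    using e1 by (intro sum_mono mono_onD[OF assms(3)]) auto
  finally have 3: "(\<Sum>w\<in>S - S0. F e) \<le> (\<Sum>i\<in>{e<..card S}. F i)" .
  show "(\<Sum>w\<in>S. F (x w)) \<le> (\<Sum>i=1..card S. F i)" using 2 3 split upper by linarith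
  assume lt: "e < card S" and sm: "strict_mono_on {1..} F"
  have "(\<Sum>i\<in>{e<..card S}. F e) < (\<Sum>i\<in>{e<..card S}. F i)"
    using e1[OF lt] lt by (intro sum_strict_mono strict_mono_onD[OF sm]) auto
  then show "(\<Sum>w\<in>S. F (x w)) < (\<Sum>i=1..card S. F i)"
    using 2 split upper card by simp
qed

lemma (in conn_graph) dist_image:
  assumes "u \<in> V"
  shows "\<exists>e. d u ` (V - {u}) = {1..e}"
proof
  let ?e = "Max (d u ` V)"
  have "d u w \<le> ?e" if "w \<in> V" for w using that by simp
  moreover have "k \<in> d u ` (V - {u})" if k: "1 \<le> k" "k \<le> ?e" for k
  proof -
    have "?e \<in> d u ` V" using nonempty by (intro Max_in) auto
    then obtain w where "w \<in> V" "d u w = ?e" by auto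
    then obtain y where "y \<in> V" "d u y = k" using dist_level[OF assms, of w k] k by auto
    then show ?thesis using k dist_self[OF assms, of E] by (intro image_eqI[of _ _ y]) auto
  qed
  ultimately show "d u ` (V - {u}) = {1..?e}" using dist_pos[OF assms] by fastforce
qed

lemma path_sum_Suc: "path_sum F (Suc n) = path_sum F n + 2 * (\<Sum>i=1..n. F i)"
  by (simp add: path_sum_def)

lemma tree_deep_leaf:
  assumes "tree_graph V E" "2 \<le> card V"
  obtains u where "u \<in> V" "conn_graph (V - {u}) {e \<in> E. e \<inter> {u} = {}}"
proof -
  obtain c where "c \<in> V" using assms by fastforce
  then obtain par where "rooted_tree V E c par" using tree_rooted assms by metis
  then interpret rooted_tree V E c par .
  have "card (V - {c}) \<noteq> 0" using assms(2) root_in by simp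
  then have "V - {c} \<noteq> {}" by fastforce
  then obtain u where u: "u \<in> V - {c}" "leaf u" using ex_leaf_max[of "V - {c}"] by blast
  then have "conn_graph (V - {u}) {e \<in> E. e \<inter> {u} = {}}" by (intro delete_leaves) (auto simp: leaf_def)
  with u that show thesis by blast
qed

lemma dist_sum_le_path_sum:
  assumes "conn_graph V E" "mono_on {1..} F"
  shows "dist_sum F V E \<le> path_sum F (card V)"
  using assms(1)
proof (induction "card V" arbitrary: V E)
  case 0
  then show ?case using conn_graph.finV[OF 0(2)] conn_graph.nonempty[OF 0(2)] by simp
next
  case (Suc n)
  interpret conn_graph V E by fact
  show ?case
  proof (cases "n = 0")
    case True
    then obtain x where "V = {x}" using Suc(2) card_1_singletonE by (metis One_nat_def)
    then show ?thesis by (simp add: dist_sum_def path_sum_def)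
  next
    case False
    obtain E' where E': "E' \<subseteq> E" "tree_graph V E'" using ex_spanning_tree[OF Suc(3)] .
    then interpret T: conn_graph V E' by (simp add: tree_graph_def)
    obtain u where u: "u \<in> V" "conn_graph (V - {u}) {e \<in> E'. e \<inter> {u} = {}}"
      using tree_deep_leaf[OF E'(2)] Suc(2) False by force
    have n: "card (V - {u}) = n" using u Suc(2) by simp
    obtain e where e: "T.d u ` (V - {u}) = {1..e}" using T.dist_image[OF u(1)] by auto
    have "dist_sum F V E \<le> dist_sum F V E'"
      using dist_sum_antimono[OF T.conn_graph_axioms Suc(3) E'(1) assms(2)] .
    also have "\<dots> \<le> dist_sum F (V - {u}) {e \<in> E'. e \<inter> {u} = {}} + 2 * (\<Sum>w\<in>V - {u}. F (T.d u w))"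
      using u by (intro dist_sum_delete[OF T.conn_graph_axioms _ _ assms(2)]) auto
    also have "\<dots> \<le> path_sum F n + 2 * (\<Sum>i=1..n. F i)"
      using Suc(1)[of "V - {u}"] u n sum_levels_le(1)[OF _ e assms(2)] by fastforce
    finally show ?thesis using Suc(2) path_sum_Suc[of F n] by simp
  qed
qed

text \<open>Equality must hold in the deletion of a single leaf, which therefore sees every distance
  exactly once.\<close>

lemma path_extremal_levels:
  assumes "tree_graph V E" "dist_sum real V E = path_sum real (card V)" "2 \<le> card V"
  obtains u where "u \<in> V" "bij_betw (graph_dist V E u) V {..<card V}"
proof -
  interpret conn_graph V E using assms by (simp add: tree_graph_def)
  have mono: "mono_on {1..} real" "strict_mono_on {1..} real" by (auto intro!: mono_onI strict_mono_onI)
  obtain u where u: "u \<in> V" "conn_graph (V - {u}) {e \<in> E. e \<inter> {u} = {}}"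
    using tree_deep_leaf[OF assms(1,3)] .
  define n where "n = card (V - {u})"
  have n: "card V = Suc n" using card_Suc_Diff1[OF finV u(1)] n_def by simp
  obtain e where e: "d u ` (V - {u}) = {1..e}" using dist_image[OF u(1)] by auto
  have "dist_sum real V E \<le> dist_sum real (V - {u}) {e \<in> E. e \<inter> {u} = {}} + 2 * (\<Sum>w\<in>V - {u}. real (d u w))"
    using u by (intro dist_sum_delete[OF conn_graph_axioms _ _ mono(1)]) auto
  also have "\<dots> \<le> path_sum real n + 2 * (\<Sum>w\<in>V - {u}. real (d u w))"
    using dist_sum_le_path_sum[OF u(2) mono(1)] n_def by simp
  finally have "(\<Sum>i=1..n. real i) \<le> (\<Sum>w\<in>V - {u}. real (d u w))"
    using assms(2) path_sum_Suc[of real n] n by simp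
  then have "\<not> e < n" using sum_levels_le(2)[OF _ e mono(1) _ mono(2)] n_def by fastforce
  moreover have "e \<le> n" using card_image_le[of "V - {u}" "d u"] e n_def by simp
  ultimately have "e = n" by simp
  then have "d u ` V = {..<card V}"
  proof -
    have "d u ` V = insert (d u u) (d u ` (V - {u}))" using u(1) by blast
    also have "\<dots> = {..<card V}" using dist_self[OF u(1)] e \<open>e = n\<close> n by auto
    finally show ?thesis .
  qed
  moreover from this have "inj_on (d u) V" by (intro eq_card_imp_inj_on) auto
  ultimately show thesis using that[OF u(1)] by (simp add: bij_betw_def)
qed

section \<open>Centroids and chords\<close>

text \<open>The branches at a vertex of a tree are recorded as the fibres of a map that is constant along
  every edge avoiding that vertex.\<close>

definition centroid :: "'a set \<Rightarrow> 'a set set \<Rightarrow> 'a \<Rightarrow> ('a \<Rightarrow> 'a) \<Rightarrow> bool" where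
  "centroid V E c br \<longleftrightarrow> c \<in> V \<and>
    (\<forall>x y. {x, y} \<in> E \<longrightarrow> x \<noteq> c \<longrightarrow> y \<noteq> c \<longrightarrow> br x = br y) \<and>
    (\<forall>t. 2 * card {w \<in> V - {c}. br w = t} \<le> card V)"

text \<open>Moving from a median to a neighbour \<open>t\<close> brings every vertex of the branch
  of \<open>t\<close> one step closer and takes the others at most one step away, so that branch has
  at most half of the vertices. A branch is labelled by its neighbour of \<open>c\<close>.\<close>

lemma (in rooted_tree) median_centroid:
  assumes median: "\<And>y. y \<in> V \<Longrightarrow> (\<Sum>w\<in>V. d c w) \<le> (\<Sum>w\<in>V. d y w)"
  shows "centroid V E c (attach c)"
proof -
  have anc: "anc c = {c}" using dist_self[OF root_in] by (simp add: anc_def)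
  have ht: "ht c w = d c w" if "w \<in> V" for w
    using ht_props[OF root_in that] depth_iter[OF that, of "ht c w"] dist_self[OF root_in] anc by auto
  have step: "attach c (par x) = attach c x" if "x \<in> V" "x \<noteq> c" "par x \<noteq> c" for x
    using attach_par[OF root_in, of x] that anc by auto
  have "2 * card {w \<in> V - {c}. attach c w = t} \<le> card V" for t
  proof (cases "{w \<in> V - {c}. attach c w = t} = {}")
    case False
    let ?B = "{w \<in> V - {c}. attach c w = t}"
    have B: "d t w \<le> d c w - 1 \<and> 1 \<le> d c w \<and> t \<in> V \<and> d c t = 1" if "w \<in> ?B" for w
    proof -
      have w: "w \<in> V" "w \<noteq> c" "t = (par ^^ (d c w - 1)) w" using that ht by (auto simp: attach_def)
      then have "1 \<le> d c w" using dist_pos[OF root_in, of w] by auto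
      then show ?thesis using dist_iter[OF w(1), of "d c w - 1"] depth_iter[OF w(1), of "d c w - 1"]
          dist_sym[of V E w t] w by auto
    qed
    then have t: "t \<in> V" "d c t = 1" using False by blast+
    have out: "d t w \<le> d c w + 1" if "w \<in> V" for w
      using dist_triangle[OF t(1) root_in that] t dist_sym[of V E c t] by simp
    have "(\<Sum>w\<in>V. d t w) + 2 * card ?B \<le> (\<Sum>w\<in>V. d c w) + card V"
    proof -
      have "(\<Sum>w\<in>V. d t w + (if w \<in> ?B then 2 else 0)) \<le> (\<Sum>w\<in>V. d c w + 1)"
        using B out by (intro sum_mono) fastforce
      moreover have "(\<Sum>w\<in>V. (if w \<in> ?B then 2 else 0)) = 2 * card ?B"
      proof -
        have "(\<Sum>w\<in>V. (if w \<in> ?B then 2 else 0::nat)) = (\<Sum>w\<in>V \<inter> ?B. 2)" by (rule sum.inter_restrict[symmetric]) simp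
        also have "V \<inter> ?B = ?B" by auto
        finally show ?thesis by simp
      qed
      ultimately show ?thesis unfolding sum.distrib by simp
    qed
    then show ?thesis using median[OF t(1)] by linarith
  next
    case True
    then show ?thesis by (simp only: card.empty)
  qed
  moreover have "attach c x = attach c y" if "{x, y} \<in> E" "x \<noteq> c" "y \<noteq> c" for x y
    using that(1) by (rule edgeE) (use step that in auto)
  ultimately show ?thesis using root_in unfolding centroid_def by blast
qed

lemma ex_centroid:
  assumes "tree_graph V E"
  obtains c br where "centroid V E c br"
proof -
  interpret conn_graph V E using assms by (simp add: tree_graph_def)
  obtain c where c: "c \<in> V" "\<And>y. y \<in> V \<Longrightarrow> (\<Sum>w\<in>V. d c w) \<le> (\<Sum>w\<in>V. d y w)"
    using arg_min_if_finite[OF finV nonempty, of "\<lambda>c. \<Sum>w\<in>V. d c w"] by (metis not_le_imp_less)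
  obtain par where "rooted_tree V E c par" using tree_rooted[OF assms c(1)] .
  then show thesis using that rooted_tree.median_centroid c(2) by metis
qed

text \<open>Here \<open>c\<close> is merely the root, in the applications a leaf, and
  \<open>x0\<close> is the centroid. A path avoiding \<open>x0\<close> would stay within one fibre
  of \<open>br\<close>.\<close>

lemma (in rooted_tree) centroid_in_anc:
  assumes "v \<in> V" "x0 \<noteq> c" "x0 \<noteq> v" "br c \<noteq> br v"
    and br: "\<And>x y. {x, y} \<in> E \<Longrightarrow> x \<noteq> x0 \<Longrightarrow> y \<noteq> x0 \<Longrightarrow> br x = br y"
  shows "x0 \<in> anc v"
proof (rule ccontr)
  assume x0: "x0 \<notin> anc v"
  have "br ((par ^^ j) v) = br v" if "j \<le> d c v" for j
    using that
  proof (induction j)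
    case (Suc j)
    let ?x = "(par ^^ j) v"
    have x: "?x \<in> V" "?x \<noteq> c" using depth_iter[OF assms(1), of j] Suc.prems dist_self[OF root_in] by auto
    have "?x \<in> anc v" "par ?x \<in> anc v" using Suc.prems unfolding anc_def
      by (auto intro!: image_eqI[of _ _ "Suc j"])
    then have "br ?x = br (par ?x)" using x0 x par_edge by (intro br) auto
    then show ?case using Suc by simp
  qed simp
  from this[of "d c v"] have "br c = br v"
    using depth_iter[OF assms(1), of "d c v"] depth_0 by auto
  with assms show False by simp
qed

text \<open>The tree is rooted at \<open>u\<close>, so that the path to the root from
  \<open>v\<close> is the path between the two. In the last claim the fibres of \<open>u\<close> and
  \<open>v\<close> need no strictness assumption, because the path already removes a vertex other
  than \<open>c\<close> from each. The map \<open>par\<close> is arbitrary there since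
  \<open>ht\<close> refers to it.\<close>

lemma pair_bound:
  assumes tree: "tree_graph V E" and match: "matching_le E m" and n3: "3 \<le> card V"
    and cen: "centroid V E c br"
    and uv: "u \<in> V" "v \<in> V" "u \<noteq> c" "v \<noteq> c" "br u \<noteq> br v"
  defines "X \<equiv> int (\<Sum>w\<in>V. graph_dist V E u w) + int (\<Sum>w\<in>V. graph_dist V E v w) - int (graph_dist V E u v)"
    and "T \<equiv> 2 * int m * (int (card V) - 1) + 2 * (int (card V) - 1 - 2 * int m)"
  shows "graph_dist V E u v = graph_dist V E u c + graph_dist V E c v" and "X \<le> T"
    and "(\<And>t. t \<noteq> br u \<Longrightarrow> t \<noteq> br v \<Longrightarrow> 2 * card {w \<in> V - {c}. br w = t} < card V) \<Longrightarrow> X = T \<Longrightarrow>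
      2 * m + 1 \<le> card V \<Longrightarrow> rooted_tree V E u par \<Longrightarrow>
      graph_dist V E u v = 2 * m \<and> (\<forall>w\<in>V. rooted_tree.ht V E u par v w \<le> 1)"
proof -
  have cV: "c \<in> V" and br: "\<And>x y. {x, y} \<in> E \<Longrightarrow> x \<noteq> c \<Longrightarrow> y \<noteq> c \<Longrightarrow> br x = br y"
    and size: "\<And>t. 2 * card {w \<in> V - {c}. br w = t} \<le> card V"
    using cen unfolding centroid_def by blast+
  have main: "graph_dist V E u v = graph_dist V E u c + graph_dist V E c v \<and> X \<le> T \<and>
    ((\<forall>t. t \<noteq> br u \<longrightarrow> t \<noteq> br v \<longrightarrow> 2 * card {w \<in> V - {c}. br w = t} < card V) \<longrightarrow> X = T \<longrightarrow>
      2 * m + 1 \<le> card V \<longrightarrow>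
      graph_dist V E u v = 2 * m \<and> (\<forall>w\<in>V. rooted_tree.ht V E u par v w \<le> 1))"
    if rt: "rooted_tree V E u par" for par
  proof -
    interpret rooted_tree V E u par by (rule rt)
    have canc: "c \<in> anc v" by (rule centroid_in_anc[of v c br]) (use uv br in auto)
    have "d v c \<le> d u v - d u c" "d u c \<le> d u v"
      using dist_anc[OF uv(2) canc] anc_eqI[OF uv(2) canc] by auto
    then have 1: "d u v = d u c + d c v"
      using dist_triangle[OF uv(1) cV uv(2)] dist_sym[of V E c v] by simp
    have sub: "{w \<in> V - anc v. br w = t} \<subseteq> {w \<in> V - {c}. br w = t}" for t using canc by auto
    have br': "\<And>x y. {x, y} \<in> E \<Longrightarrow> x \<notin> anc v \<Longrightarrow> y \<notin> anc v \<Longrightarrow> br x = br y"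
      using br canc by blast
    have size': "2 * card {w \<in> V - anc v. br w = t} \<le> card V" for t
      using size[of t] card_mono[OF _ sub[of t]] finV by fastforce
    note pb = pair_distance_bound[OF match uv(2) n3 br' size', folded X_def T_def]
    have "d u v = 2 * m \<and> (\<forall>w\<in>V. ht v w \<le> 1)"
      if strict: "\<forall>t. t \<noteq> br u \<longrightarrow> t \<noteq> br v \<longrightarrow> 2 * card {w \<in> V - {c}. br w = t} < card V"
        and XT: "X = T" and m: "2 * m + 1 \<le> card V"
    proof (rule pb(2))
      fix t
      show "2 * card {w \<in> V - anc v. br w = t} < card V"
      proof (cases "t = br u \<or> t = br v")
        case True
        then have "{w \<in> V - anc v. br w = t} \<subset> {w \<in> V - {c}. br w = t}"
          using sub[of t] uv self_in_anc[of v] root_in_anc[OF uv(2)] by blast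
        then have "card {w \<in> V - anc v. br w = t} < card {w \<in> V - {c}. br w = t}"
          by (intro psubset_card_mono) auto
        then show ?thesis using size[of t] by linarith
      next
        case False
        then have "2 * card {w \<in> V - {c}. br w = t} < card V" using strict by blast
        then show ?thesis using card_mono[OF _ sub[of t]] finV by fastforce
      qed
      show "2 \<le> d u v" using 1 dist_pos[OF uv(1) cV uv(3)] dist_pos[OF cV uv(2)] uv(4) by simp
    qed (use XT m in auto)
    with 1 pb(1) show ?thesis by blast
  qed
  obtain par' where "rooted_tree V E u par'" using tree_rooted[OF tree uv(1)] .
  from main[OF this] show "graph_dist V E u v = graph_dist V E u c + graph_dist V E c v" "X \<le> T" by auto
  assume "\<And>t. t \<noteq> br u \<Longrightarrow> t \<noteq> br v \<Longrightarrow> 2 * card {w \<in> V - {c}. br w = t} < card V"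
    "X = T" "2 * m + 1 \<le> card V" "rooted_tree V E u par"
  with main[of par] show "graph_dist V E u v = 2 * m \<and> (\<forall>w\<in>V. rooted_tree.ht V E u par v w \<le> 1)" by blast
qed

text \<open>Convexity as a three-point inequality without division, on positive indices because only
  distances between distinct vertices are weighted.\<close>

definition convex_seq :: "(nat \<Rightarrow> real) \<Rightarrow> bool" where
  "convex_seq F \<longleftrightarrow> (\<forall>a b c. 1 \<le> a \<longrightarrow> a \<le> b \<longrightarrow> b \<le> c \<longrightarrow>
     (real c - real a) * F b \<le> (real c - real b) * F a + (real b - real a) * F c)"

text \<open>The line passes through the points at 2 and \<open>e\<close>; 2 is the least distance
  from a leaf to any vertex but its neighbour. For \<open>e = 2\<close> the chord degenerates and
  the line through 2 and 3 takes its place.\<close>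

lemma convex_seq_chord:
  assumes "convex_seq F" "mono_on {1..} F" "2 \<le> e"
  obtains s where "0 \<le> s" "\<And>x. 2 \<le> x \<Longrightarrow> x \<le> e \<Longrightarrow> F x \<le> F 2 + s * (real x - 2)"
    "\<And>x. e \<le> x \<Longrightarrow> F 2 + s * (real x - 2) \<le> F x"
proof -
  have cv: "(real c - real a) * F b \<le> (real c - real b) * F a + (real b - real a) * F c"
    if "1 \<le> a" "a \<le> b" "b \<le> c" for a b c using assms(1) that unfolding convex_seq_def by blast
  show thesis
  proof (cases "e = 2")
    case True
    have m: "F 2 \<le> F 3" using mono_onD[OF assms(2), of 2 3] by simp
    show ?thesis
    proof (rule that[of "F 3 - F 2"])
      fix x assume "e \<le> x"
      show "F 2 + (F 3 - F 2) * (real x - 2) \<le> F x"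
      proof (cases "x = 2")
        case False
        then show ?thesis using cv[of 2 3 x] \<open>e \<le> x\<close> True by (simp add: algebra_simps)
      qed simp
    next
      fix x assume "2 \<le> x" "x \<le> e"
      then have "x = 2" using True by simp
      then show "F x \<le> F 2 + (F 3 - F 2) * (real x - 2)" by simp
    qed (use m in simp)
  next
    case False
    define s where "s = (F e - F 2) / (real e - 2)"
    have e: "real e - 2 > 0" using False assms(3) by simp
    have m: "F 2 \<le> F e" using mono_onD[OF assms(2), of 2 e] assms(3) by simp
    have s: "s * (real e - 2) = F e - F 2" using e by (simp add: s_def)
    show ?thesis
    proof (rule that[of s])
      show "0 \<le> s" using m e by (simp add: s_def)
    next
      fix x assume "2 \<le> x" "x \<le> e"
      then have "(real e - 2) * F x \<le> (real e - real x) * F 2 + (real x - 2) * (F 2 + s * (real e - 2))"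
        using cv[of 2 x e] s by simp
      also have "\<dots> = (real e - 2) * (F 2 + s * (real x - 2))" by (simp add: algebra_simps)
      finally show "F x \<le> F 2 + s * (real x - 2)" using e by simp
    next
      fix x assume "e \<le> x"
      then have "(real x - 2) * (F 2 + s * (real e - 2)) \<le> (real x - real e) * F 2 + (real e - 2) * F x"
        using cv[of 2 e x] s assms(3) by simp
      then have "(real e - 2) * (F 2 + s * (real x - 2)) \<le> (real e - 2) * F x" by (simp add: algebra_simps)
      then show "F 2 + s * (real x - 2) \<le> F x" using e by simp
    qed
  qed
qed

text \<open>The distances seen from a leaf: one vertex at each of \<open>1, ..., e - 1\<close> and
  all others between 2 and \<open>e\<close>. Level \<open>e\<close> itself is not demanded, because
  for the second deleted leaf the only vertex at that distance may be the first one, which is no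
  longer in \<open>S\<close>.\<close>

definition levels :: "'a set \<Rightarrow> ('a \<Rightarrow> nat) \<Rightarrow> nat \<Rightarrow> bool" where
  "levels S x e \<longleftrightarrow> finite S \<and> (\<exists>S0\<subseteq>S. bij_betw x S0 {1..<e} \<and> (\<forall>w\<in>S - S0. 2 \<le> x w \<and> x w \<le> e))"

lemma sum_nat_interval: "2 * (\<Sum>i\<in>{1..<e}. real i) = real e * (real e - 1)"
proof (induction e)
  case (Suc e)
  then show ?case by (cases e) (auto simp: algebra_simps sum.atLeastLessThan_Suc)
qed simp

lemma levels_sum_le:
  assumes "levels S x e" "1 \<le> e"
  shows "2 * (\<Sum>w\<in>S. real (x w)) \<le> real e * (real e - 1) + 2 * real e * (real (card S) - real e + 1)"
proof -
  obtain S0 where S0: "S0 \<subseteq> S" "bij_betw x S0 {1..<e}" "\<And>w. w \<in> S - S0 \<Longrightarrow> 2 \<le> x w \<and> x w \<le> e"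
    and fin: "finite S" using assms unfolding levels_def by auto
  have "card S0 = e - 1" using bij_betw_same_card[OF S0(2)] by simp
  then have card: "real (card (S - S0)) = real (card S) - real e + 1"
    using card_Diff_subset[OF finite_subset[OF S0(1) fin] S0(1)] card_mono[OF fin S0(1)] assms(2) by simp
  have "(\<Sum>w\<in>S. real (x w)) = (\<Sum>w\<in>S - S0. real (x w)) + (\<Sum>w\<in>S0. real (x w))"
    using sum.subset_diff[OF S0(1) fin] .
  also have "(\<Sum>w\<in>S0. real (x w)) = (\<Sum>i\<in>{1..<e}. real i)" using sum.reindex_bij_betw[OF S0(2), of real] by simp
  also have "(\<Sum>w\<in>S - S0. real (x w)) \<le> real (card (S - S0)) * real e"
    using S0(3) by (intro sum_bounded_above) auto
  finally show ?thesis using sum_nat_interval[of e] card by (simp add: algebra_simps)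
qed

text \<open>On \<open>[2, e]\<close> the function lies below its chord, outside it lies above; comparing chord values
  turns the bound on the sum of the distances into one on the sum of their \<open>F\<close>-values.\<close>

lemma levels_chord:
  assumes "levels S x e" "2 \<le> e" "e \<le> 2 * m" "convex_seq F" "mono_on {1..} F" "0 \<le> \<beta>"
  defines "K \<equiv> real (card S) - (2 * real m - 1)"
  assumes lin: "(\<Sum>w\<in>S. real (x w)) \<le> real m * (2 * real m - 1) + 2 * real m * \<beta> + 2 * (K - \<beta>)"
  shows "(\<Sum>w\<in>S. F (x w)) \<le> (\<Sum>i\<in>{1..<2 * m}. F i) + \<beta> * F (2 * m) + (K - \<beta>) * F 2"
proof -
  obtain S0 where S0: "S0 \<subseteq> S" "bij_betw x S0 {1..<e}" "\<And>w. w \<in> S - S0 \<Longrightarrow> 2 \<le> x w \<and> x w \<le> e"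
    and fin: "finite S" using assms(1) unfolding levels_def by auto
  obtain s where s: "0 \<le> s" "\<And>x. 2 \<le> x \<Longrightarrow> x \<le> e \<Longrightarrow> F x \<le> F 2 + s * (real x - 2)"
    "\<And>x. e \<le> x \<Longrightarrow> F 2 + s * (real x - 2) \<le> F x" using convex_seq_chord[OF assms(4,5,2)] by blast
  have "card S0 = e - 1" using bij_betw_same_card[OF S0(2)] by simp
  then have card: "real (card (S - S0)) = real (card S) - real e + 1"
    using card_Diff_subset[OF finite_subset[OF S0(1) fin] S0(1)] card_mono[OF fin S0(1)] assms(2) by simp
  have split: "(\<Sum>w\<in>S. g (x w)) = (\<Sum>w\<in>S - S0. g (x w)) + (\<Sum>i\<in>{1..<e}. g i)" for g :: "nat \<Rightarrow> real"
    using sum.subset_diff[OF S0(1) fin, of "\<lambda>w. g (x w)"] sum.reindex_bij_betw[OF S0(2), of g] by simp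
  have split2: "(\<Sum>i\<in>{1..<2 * m}. g i) = (\<Sum>i\<in>{1..<e}. g i) + (\<Sum>i\<in>{e..<2 * m}. g i)" for g :: "nat \<Rightarrow> real"
    using assms(2,3) by (intro sum.atLeastLessThan_concat[symmetric]) auto
  \<comment> \<open>\<open>?A\<close> sums the distances beyond one vertex per level below
    \<open>e\<close>. The double broom has instead one vertex on each level from \<open>e\<close> to
    \<open>2 * m - 1\<close>, summed in \<open>?C\<close>.\<close>
  let ?A = "\<Sum>w\<in>S - S0. real (x w)" and ?C = "\<Sum>i\<in>{e..<2 * m}. real i"
  have "(\<Sum>w\<in>S - S0. F (x w)) \<le> (\<Sum>w\<in>S - S0. F 2 + s * (real (x w) - 2))"
    using S0(3) s(2) by (intro sum_mono) auto
  also have "\<dots> = (real (card S) - real e + 1) * (F 2 - 2 * s) + s * ?A"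
    unfolding card[symmetric] by (simp add: sum.distrib sum_subtractf sum_distrib_left algebra_simps)
  finally have up: "(\<Sum>w\<in>S - S0. F (x w)) \<le> (real (card S) - real e + 1) * (F 2 - 2 * s) + s * ?A" .
  have "(2 * real m - real e) * (F 2 - 2 * s) + s * ?C = (\<Sum>i\<in>{e..<2 * m}. F 2 + s * (real i - 2))"
    using assms(3) by (simp add: sum.distrib sum_subtractf sum_distrib_left algebra_simps)
  also have "\<dots> \<le> (\<Sum>i\<in>{e..<2 * m}. F i)" using s(3) by (intro sum_mono) auto
  finally have lo: "(2 * real m - real e) * (F 2 - 2 * s) + s * ?C \<le> (\<Sum>i\<in>{e..<2 * m}. F i)" .
  have lo2: "\<beta> * (F 2 + s * (2 * real m - 2)) \<le> \<beta> * F (2 * m)"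
    using s(3)[of "2 * m"] assms(3,6) by (intro mult_left_mono) auto
  have "2 * (\<Sum>i\<in>{1..<2 * m}. real i) = 2 * (real m * (2 * real m - 1))"
    unfolding sum_nat_interval by simp
  then have "?A \<le> ?C + 2 * real m * \<beta> + 2 * (K - \<beta>)"
    using lin split[of real] split2[of real] by linarith
  then have "s * ?A \<le> s * (?C + 2 * real m * \<beta> + 2 * (K - \<beta>))" using s(1) by (intro mult_left_mono)
  then have "s * ?A \<le> s * ?C + s * (2 * real m * \<beta> + 2 * (K - \<beta>))" by (simp add: algebra_simps)
  then have "(\<Sum>w\<in>S - S0. F (x w)) \<le> (real (card S) - real e + 1) * (F 2 - 2 * s) + s * ?C + s * (2 * real m * \<beta> + 2 * (K - \<beta>))"
    using up by linarith
  also have "\<dots> = ((2 * real m - real e) * (F 2 - 2 * s) + s * ?C) + \<beta> * (F 2 + s * (2 * real m - 2)) + (K - \<beta>) * F 2"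
    unfolding K_def by (simp add: algebra_simps)
  also have "\<dots> \<le> (\<Sum>i\<in>{e..<2 * m}. F i) + \<beta> * F (2 * m) + (K - \<beta>) * F 2" using lo lo2 by linarith
  finally show ?thesis using split[of F] split2[of F] by linarith
qed

section \<open>The upper bound\<close>

lemma nonneg_product:
  fixes D m n :: real
  assumes "D + 1 \<le> 2 * m" "2 * m + 1 \<le> n"
  shows "0 \<le> (2 * m - D) * (2 * n - 3 - 2 * m - D)"
  using assms by (intro mult_nonneg_nonneg) linarith+

text \<open>In the broom, \<open>n - 2m\<close> of the counted distances equal \<open>2m\<close>,
  over both leaves together. A real number \<open>\<beta>\<close> of them is assigned to
  \<open>u\<close> and the rest to \<open>v\<close>; \<open>\<beta>\<close> cancels in the sum of
  the two \<open>F\<close>-bounds, so it may be fitted to the actual distance sums.\<close>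

lemma levels_pair_chord:
  fixes n m :: nat
  assumes u: "levels Su xu e" "2 \<le> e" "e \<le> 2 * m" "real (card Su) = real n - 1"
    and v: "levels Sv xv D" "2 \<le> D" "D \<le> 2 * m" "real (card Sv) = real n - 2"
    and n: "2 * m + 1 \<le> n" and F: "convex_seq F" "mono_on {1..} F"
    and lin: "(\<Sum>w\<in>Su. real (xu w)) + (\<Sum>w\<in>Sv. real (xv w)) \<le>
      2 * real m * (real n - 1) + 2 * (real n - 1 - 2 * real m)"
  shows "(\<Sum>w\<in>Su. F (xu w)) + (\<Sum>w\<in>Sv. F (xv w)) \<le>
    2 * (\<Sum>i\<in>{1..<2 * m}. F i) + (real n - 2 * real m) * F (2 * m) + (real n - 2 * real m - 1) * F 2"
proof -
  define Lu Lv where "Lu = (\<Sum>w\<in>Su. real (xu w))" and "Lv = (\<Sum>w\<in>Sv. real (xv w))"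
  define b0 where "b0 = real m * (2 * real m - 1) + 2 * (real n - 2 * real m)"
  have m1: "1 \<le> real m" using u by simp
  have n': "2 * real m + 1 \<le> real n" using n by linarith
  have e: "real e \<le> 2 * real m" "2 \<le> real e" using u by linarith+
  have D: "real D \<le> 2 * real m" "2 \<le> real D" using v by linarith+
  have combine: ?thesis if "0 \<le> \<beta>" "\<beta> \<le> real n - 2 * real m"
    "Lu \<le> real m * (2 * real m - 1) + 2 * real m * \<beta> + 2 * (real n - 2 * real m - \<beta>)"
    "Lv \<le> real m * (2 * real m - 1) + 2 * real m * (real n - 2 * real m - \<beta>) + 2 * (\<beta> - 1)" for \<beta>
  proof -
    have "(\<Sum>w\<in>Su. F (xu w)) \<le> (\<Sum>i\<in>{1..<2 * m}. F i) + \<beta> * F (2 * m) + (real n - 2 * real m - \<beta>) * F 2"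
      using levels_chord[OF u(1-3) F that(1)] that(3) u(4) unfolding Lu_def by (simp add: algebra_simps)
    moreover have "(\<Sum>w\<in>Sv. F (xv w)) \<le> (\<Sum>i\<in>{1..<2 * m}. F i) + (real n - 2 * real m - \<beta>) * F (2 * m) + (\<beta> - 1) * F 2"
      using levels_chord[OF v(1-3) F, of "real n - 2 * real m - \<beta>"] that(2,4) v(4) unfolding Lv_def by (simp add: algebra_simps)
    ultimately show ?thesis by (simp add: algebra_simps)
  qed
  have Lu_le: "Lu \<le> real m * (2 * real m - 1) + 2 * real m * (real n - 2 * real m)"
  proof -
    have "0 \<le> (2 * real m - real e) * (2 * real n - (2 * real m + real e + 1))"
      using e n' by (intro mult_nonneg_nonneg) linarith+
    then show ?thesis using levels_sum_le[OF u(1)] u unfolding Lu_def by (simp add: algebra_simps)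
  qed
  \<comment> \<open>This is the requirement on \<open>v\<close> at \<open>\<beta> = 0\<close>; the
    final 2 comes from the number \<open>\<beta> - 1\<close> of distances equal to 2.\<close>
  have Lv_le: "Lv \<le> real m * (2 * real m - 1) + 2 * real m * (real n - 2 * real m) - 2"
  proof -
    have "0 \<le> (2 * real m - real D) * (2 * real n - 3 - 2 * real m - real D)"
    proof (cases "D = 2 * m")
      case False
      then have "real D + 1 \<le> 2 * real m" using v by linarith
      then show ?thesis using n' by (rule nonneg_product)
    qed simp
    then show ?thesis using levels_sum_le[OF v(1)] v m1 unfolding Lv_def by (simp add: algebra_simps)
  qed
  show ?thesis
  proof (cases "Lu \<le> b0")
    case True
    then show ?thesis using combine[of 0] Lv_le n' unfolding b0_def by simp
  next
    case False
    \<comment> \<open>For \<open>m = 1\<close> the value \<open>b0\<close> equals the bound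
      \<open>Lu_le\<close>, which this case exceeds; hence the division below is by a positive
      number.\<close>
    then have m2: "2 * real m - 2 > 0"
      using Lu_le m1 unfolding b0_def by (cases "real m = 1") auto
    \<comment> \<open>Chosen to make the requirement on \<open>u\<close> an equality, so that the
      bound on the sum becomes the requirement on \<open>v\<close>.\<close>
    define \<beta> where "\<beta> = (Lu - b0) / (2 * real m - 2)"
    have \<beta>: "(2 * real m - 2) * \<beta> = Lu - b0" using m2 by (simp add: \<beta>_def)
    have 1: "0 \<le> \<beta>" using False m2 by (simp add: \<beta>_def)
    have "(2 * real m - 2) * \<beta> \<le> (2 * real m - 2) * (real n - 2 * real m)"
      unfolding \<beta> using Lu_le unfolding b0_def by (simp add: algebra_simps)
    then have 2: "\<beta> \<le> real n - 2 * real m" using m2 by simp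
    have 3: "Lu = b0 + 2 * real m * \<beta> - 2 * \<beta>" using \<beta> by (simp add: algebra_simps)
    have 4: "Lu + Lv \<le> 2 * real m * (real n - 1) + 2 * (real n - 1 - 2 * real m)"
      using lin by (simp add: Lu_def Lv_def)
    show ?thesis by (rule combine[OF 1 2]) (use 3 4 in \<open>simp_all add: b0_def algebra_simps\<close>)
  qed
qed

text \<open>The only neighbour of \<open>z\<close> must represent level 1, so every vertex outside
  the representatives has distance at least 2.\<close>

lemma (in conn_graph) leaf_levels:
  assumes "z \<in> V" "\<And>y y'. {z, y} \<in> E \<Longrightarrow> {z, y'} \<in> E \<Longrightarrow> y = y'" "S \<subseteq> V - {z}"
    "{1..<e} \<subseteq> d z ` S" "\<And>w. w \<in> S \<Longrightarrow> d z w \<le> e" "2 \<le> e"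
  shows "levels S (d z) e"
proof -
  obtain S0 where S0: "S0 \<subseteq> S" "bij_betw (d z) S0 {1..<e}" using level_selection[OF assms(4)] .
  have "1 \<in> d z ` S0" using S0(2) assms(6) by (auto simp: bij_betw_def)
  then obtain y where y: "y \<in> S0" "d z y = 1" by auto
  have "2 \<le> d z w" if "w \<in> S - S0" for w
  proof -
    have w: "w \<in> V" "w \<noteq> z" using that assms(3) by auto
    have "y \<in> V" using y S0 assms(3) by auto
    then have "{z, y} \<in> E" using dist_1[OF assms(1)] y by auto
    have "d z w \<noteq> 1"
    proof
      assume "d z w = 1"
      then have "{z, w} \<in> E" using dist_1[OF assms(1) w(1)] by auto
      with \<open>{z, y} \<in> E\<close> assms(2) have "w = y" by blast
      with that y show False by auto
    qed
    then show ?thesis using dist_pos[OF assms(1) w(1)] w(2) by auto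
  qed
  moreover have "finite S" using assms(3) finite_subset[OF _ finV] by auto
  ultimately show ?thesis unfolding levels_def using S0 assms(5) by blast
qed

context rooted_tree
begin

lemma branch_leaf:
  assumes cen: "centroid V E c br" and "w0 \<in> V - {c}"
  obtains z where "leaf z" "br z = br w0"
proof -
  let ?S = "{w \<in> V - {c}. br w = br w0}"
  have closed: "w \<in> ?S" if "w \<in> V - {c}" "par w \<in> ?S" for w
    using that cen par_edge[of w] unfolding centroid_def by auto
  have sub: "?S \<subseteq> V - {c}" and ne: "?S \<noteq> {}" using assms(2) by auto
  obtain z where z: "z \<in> ?S" "leaf z" "\<forall>w\<in>?S. d c w \<le> d c z"
    using ex_leaf_max[OF sub ne closed] .
  have "br z = br w0" using z(1) by simp
  with z(2) show thesis by (rule that)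
qed

lemma other_branch:
  assumes cen: "centroid V E c br" and "3 \<le> card V"
  obtains w where "w \<in> V - {c}" "br w \<noteq> t"
proof -
  have "2 * card {w \<in> V - {c}. br w = t} \<le> card V" using cen by (simp add: centroid_def)
  moreover have "card (V - {c}) = card V - 1" using root_in by simp
  ultimately have "card {w \<in> V - {c}. br w = t} \<noteq> card (V - {c})" using assms(2) by linarith
  then have "{w \<in> V - {c}. br w = t} \<noteq> V - {c}" by metis
  then show thesis using that by blast
qed

lemma leaves_delete:
  assumes "leaf u" "leaf v"
  shows "conn_graph (V - {u, v}) {e \<in> E. e \<inter> {u, v} = {}}"
  by (rule delete_leaves) (use assms in \<open>auto simp: leaf_def\<close>)

end

lemma tree_dist_le_matching:
  assumes "tree_graph V E" "matching_le E m" "u \<in> V" "v \<in> V"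
  shows "graph_dist V E u v \<le> 2 * m"
proof -
  obtain par where "rooted_tree V E u par" using tree_rooted[OF assms(1,3)] .
  then show ?thesis using rooted_tree.depth_le_matching assms by metis
qed

lemma pair_bound_real:
  assumes "tree_graph V E" "matching_le E m" "3 \<le> card V" "centroid V E c br"
    "u \<in> V" "v \<in> V" "u \<noteq> c" "v \<noteq> c" "br u \<noteq> br v"
  defines "X \<equiv> int (\<Sum>w\<in>V. graph_dist V E u w) + int (\<Sum>w\<in>V. graph_dist V E v w) - int (graph_dist V E u v)"
  shows "(\<Sum>w\<in>V - {u}. real (graph_dist V E u w)) + (\<Sum>w\<in>V - {u, v}. real (graph_dist V E v w)) = real_of_int X"
    and "real_of_int X \<le> 2 * real m * (real (card V) - 1) + 2 * (real (card V) - 1 - 2 * real m)"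
proof -
  interpret conn_graph V E using assms(1) by (simp add: tree_graph_def)
  have "(\<Sum>w\<in>V. real (d u w)) = (\<Sum>w\<in>V - {u}. real (d u w))"
    using sum.remove[OF finV assms(5), of "\<lambda>w. real (d u w)"] dist_self[OF assms(5)] by simp
  moreover have "(\<Sum>w\<in>V. real (d v w)) = (\<Sum>w\<in>V - {u, v}. real (d v w)) + real (d u v)"
  proof -
    have "(\<Sum>w\<in>V. real (d v w)) = (\<Sum>w\<in>V - {v}. real (d v w))"
      using sum.remove[OF finV assms(6), of "\<lambda>w. real (d v w)"] dist_self[OF assms(6)] by simp
    also have "\<dots> = real (d v u) + (\<Sum>w\<in>V - {v} - {u}. real (d v w))"
      using assms by (intro sum.remove) auto
    also have "V - {v} - {u} = V - {u, v}" by auto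
    finally show ?thesis using dist_sym[of V E u v] by simp
  qed
  ultimately show "(\<Sum>w\<in>V - {u}. real (d u w)) + (\<Sum>w\<in>V - {u, v}. real (d v w)) = real_of_int X"
    unfolding X_def by simp
  have "real_of_int X \<le> real_of_int (2 * int m * (int (card V) - 1) + 2 * (int (card V) - 1 - 2 * int m))"
    using pair_bound(2)[OF assms(1-9)] unfolding X_def of_int_le_iff .
  then show "real_of_int X \<le> 2 * real m * (real (card V) - 1) + 2 * (real (card V) - 1 - 2 * real m)" by simp
qed

lemma ex_good_pair:
  assumes tree: "tree_graph V E" and match: "matching_le E m" and n: "2 * m + 1 \<le> card V" and m: "1 \<le> m"
    and F: "convex_seq F" "mono_on {1..} F"
  obtains u v where "u \<in> V" "v \<in> V" "u \<noteq> v" "conn_graph (V - {u, v}) {e \<in> E. e \<inter> {u, v} = {}}"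
    "(\<Sum>w\<in>V - {u}. F (graph_dist V E u w)) + (\<Sum>w\<in>V - {u, v}. F (graph_dist V E v w)) \<le>
      2 * (\<Sum>i\<in>{1..<2 * m}. F i) + (real (card V) - 2 * real m) * F (2 * m) + (real (card V) - 2 * real m - 1) * F 2"
proof -
  obtain c br where cen: "centroid V E c br" using ex_centroid[OF tree] .
  have n3: "3 \<le> card V" using n m by simp
  have cV: "c \<in> V" using cen by (simp add: centroid_def)
  obtain par where "rooted_tree V E c par" using tree_rooted[OF tree cV] .
  then interpret rooted_tree V E c par .
  have "card (V - {c}) \<noteq> 0" using n3 root_in by simp
  then have "V - {c} \<noteq> {}" by fastforce
  then obtain u where u: "u \<in> V - {c}" "leaf u" "\<forall>w\<in>V - {c}. d c w \<le> d c u"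
    using ex_leaf_max[of "V - {c}"] by blast
  obtain w0 where "w0 \<in> V - {c}" "br w0 \<noteq> br u" using other_branch[OF cen n3] .
  then obtain v where v: "leaf v" "br v \<noteq> br u" using branch_leaf[OF cen, of w0] by metis
  have uv: "u \<in> V" "v \<in> V" "u \<noteq> c" "v \<noteq> c" "br u \<noteq> br v" "u \<noteq> v" using u v by (auto simp: leaf_def)
  define D where "D = d u v"
  have Deq: "D = d u c + d c v" using pair_bound(1)[OF tree match n3 cen uv(1-5)] D_def by simp
  have D2: "2 \<le> D" using Deq dist_pos[OF uv(1) cV uv(3)] dist_pos[OF cV uv(2)] uv(4) by simp
  have leafu: "y = y'" if "{u, y} \<in> E" "{u, y'} \<in> E" for y y' using leaf_neighbour[OF u(2)] that by metis
  have leafv: "y = y'" if "{v, y} \<in> E" "{v, y'} \<in> E" for y y' using leaf_neighbour[OF v(1)] that by metis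
  obtain e where e: "d u ` (V - {u}) = {1..e}" using dist_image[OF uv(1)] by auto
  have "D \<in> d u ` (V - {u})" using uv D_def by auto
  then have De: "D \<le> e" unfolding e by simp
  have le: "d x y \<le> 2 * m" if "x \<in> V" "y \<in> V" for x y using tree_dist_le_matching[OF tree match that] .
  have "e \<in> d u ` (V - {u})" unfolding e using De D2 by simp
  then have e2m: "e \<le> 2 * m" using le uv(1) by auto
  have lu: "levels (V - {u}) (d u) e"
  proof (rule leaf_levels[OF uv(1) leafu])
    show "d u w \<le> e" if "w \<in> V - {u}" for w using imageI[OF that, of "d u"] unfolding e by simp
  qed (use e De D2 in auto)
  have lv: "levels (V - {u, v}) (d v) D"
  proof (rule leaf_levels[OF uv(2) leafv])
    show "{1..<D} \<subseteq> d v ` (V - {u, v})"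
    proof
      fix k assume k: "k \<in> {1..<D}"
      have dvu: "d v u = D" using D_def dist_sym[of V E u v] by simp
      then obtain y where y: "y \<in> V" "d v y = k" using dist_level[OF uv(2,1), of k] k by auto
      then have "y \<noteq> v" "y \<noteq> u" using k dvu dist_self[OF uv(2), of E] by auto
      with y show "k \<in> d v ` (V - {u, v})" by auto
    qed
    \<comment> \<open>The choice of \<open>u\<close> farthest from \<open>c\<close> enters here: the
      route through \<open>c\<close> shows that no vertex is farther from \<open>v\<close> than
      \<open>u\<close> is.\<close>
    show "d v w \<le> D" if "w \<in> V - {u, v}" for w
    proof (cases "w = c")
      case True
      then show ?thesis using Deq dist_sym[of V E c v] by simp
    next
      case False
      then have "d c w \<le> d c u" using u(3) that by auto
      then show ?thesis using dist_triangle[OF uv(2) cV, of w] that Deq dist_sym[of V E c v] dist_sym[of V E c u] by auto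
    qed
  qed (use D2 in auto)
  have cards: "real (card (V - {u})) = real (card V) - 1" "real (card (V - {u, v})) = real (card V) - 2"
    using uv n3 by (simp_all add: card_Diff_subset)
  have "(\<Sum>w\<in>V - {u}. F (d u w)) + (\<Sum>w\<in>V - {u, v}. F (d v w)) \<le>
      2 * (\<Sum>i\<in>{1..<2 * m}. F i) + (real (card V) - 2 * real m) * F (2 * m) + (real (card V) - 2 * real m - 1) * F 2"
  proof (rule levels_pair_chord[OF lu _ e2m cards(1) lv D2 _ cards(2) n F])
    show "2 \<le> e" using De D2 by simp
    show "D \<le> 2 * m" using le uv D_def by simp
    show "(\<Sum>w\<in>V - {u}. real (d u w)) + (\<Sum>w\<in>V - {u, v}. real (d v w)) \<le>
      2 * real m * (real (card V) - 1) + 2 * (real (card V) - 1 - 2 * real m)"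
      using pair_bound_real[OF tree match n3 cen uv(1-5)] by simp
  qed
  with that uv leaves_delete[OF u(2) v(1)] show thesis by blast
qed

text \<open>The ordered distance sum of the double broom with \<open>a\<close> and \<open>b\<close>
  pendent vertices: pairs on the path, pairs of a pendent and a path vertex, pendent pairs at the
  same end, pendent pairs at opposite ends. Unbalanced \<open>a\<close>, \<open>b\<close> are needed
  for uniqueness.\<close>

definition broom_sum :: "(nat \<Rightarrow> real) \<Rightarrow> nat \<Rightarrow> nat \<Rightarrow> nat \<Rightarrow> real" where
  "broom_sum F m a b = path_sum F (2 * m - 1) + 2 * (real a + real b) * (\<Sum>i\<in>{1..<2 * m}. F i) +
     (real a * (real a - 1) + real b * (real b - 1)) * F 2 + 2 * real a * real b * F (2 * m)"

text \<open>The gain from one more pendent vertex at each end is twice the bound of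
  \<open>ex_good_pair\<close>: the larger broom has \<open>n\<close> vertices with
  \<open>a + b + 1 = n - 2m\<close>.\<close>

lemma broom_sum_Suc_Suc:
  "broom_sum F m (Suc a) (Suc b) = broom_sum F m a b +
    2 * (2 * (\<Sum>i\<in>{1..<2 * m}. F i) + (real a + real b + 1) * F (2 * m) + (real a + real b) * F 2)"
  by (simp add: broom_sum_def algebra_simps)

lemma broom_sum_0_0: "broom_sum F m 0 0 = path_sum F (2 * m - 1)"
  by (simp add: broom_sum_def)

lemma broom_sum_1_0: "1 \<le> m \<Longrightarrow> broom_sum F m 1 0 = path_sum F (2 * m)"
proof -
  assume "1 \<le> m"
  then have "2 * m = Suc (2 * m - 1)" by simp
  moreover have "{1..<2 * m} = {1..2 * m - 1}" using \<open>1 \<le> m\<close> by auto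
  ultimately show ?thesis using path_sum_Suc[of F "2 * m - 1"] by (simp add: broom_sum_def)
qed

theorem dist_sum_le_broom_sum:
  assumes "conn_graph V E" "matching_le E m" "1 \<le> m" "2 * m \<le> card V + 1"
    and F: "convex_seq F" "mono_on {1..} F"
  shows "dist_sum F V E \<le> broom_sum F m ((card V + 2 - 2 * m) div 2) ((card V + 1 - 2 * m) div 2)"
  using assms(1,2,4)
proof (induction "card V" arbitrary: V E rule: less_induct)
  case less
  interpret conn_graph V E by fact
  show ?case
  proof (cases "2 * m + 1 \<le> card V")
    case False
    then have "card V = 2 * m - 1 \<or> card V = 2 * m" using less(4) by auto
    then have "broom_sum F m ((card V + 2 - 2 * m) div 2) ((card V + 1 - 2 * m) div 2) = path_sum F (card V)"
      using broom_sum_0_0[of F m] broom_sum_1_0[OF assms(3), of F] assms(3) by auto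
    then show ?thesis using dist_sum_le_path_sum[OF less(2) F(2)] by simp
  next
    case True
    obtain E' where E': "E' \<subseteq> E" "tree_graph V E'" using ex_spanning_tree[OF less(2)] .
    then have T: "conn_graph V E'" by (simp add: tree_graph_def)
    have ml: "matching_le E' m" using matching_le_subset less(3) E'(1) by blast
    obtain u v where uv: "u \<in> V" "v \<in> V" "u \<noteq> v" and c2: "conn_graph (V - {u, v}) {e \<in> E'. e \<inter> {u, v} = {}}"
      and le: "(\<Sum>w\<in>V - {u}. F (graph_dist V E' u w)) + (\<Sum>w\<in>V - {u, v}. F (graph_dist V E' v w)) \<le>
      2 * (\<Sum>i\<in>{1..<2 * m}. F i) + (real (card V) - 2 * real m) * F (2 * m) + (real (card V) - 2 * real m - 1) * F 2"
      using ex_good_pair[OF E'(2) ml True assms(3) F] .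
    let ?E2 = "{e \<in> E'. e \<inter> {u, v} = {}}"
    have card2: "card (V - {u, v}) = card V - 2" using uv by (simp add: card_Diff_subset)
    obtain k where k: "card V = 2 * m + 1 + k" using True le_Suc_ex by blast
    define a b where "a = (k + 1) div 2" and "b = k div 2"
    have "a + b = k" unfolding a_def b_def by presburger
    then have ab: "real a + real b = real (card V) - 2 * real m - 1" using k by simp
    have "dist_sum F V E \<le> dist_sum F V E'" using dist_sum_antimono[OF T less(2) E'(1) F(2)] .
    also have "\<dots> \<le> dist_sum F (V - {u, v}) ?E2 +
       2 * ((\<Sum>w\<in>V - {u}. F (graph_dist V E' u w)) + (\<Sum>w\<in>V - {u, v}. F (graph_dist V E' v w)))"
      using uv by (intro dist_sum_delete2[OF T c2 _ F(2)]) auto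
    also have "dist_sum F (V - {u, v}) ?E2 \<le> broom_sum F m a b"
    proof -
      have "matching_le ?E2 m" using matching_le_subset[OF ml] by auto
      moreover have "card (V - {u, v}) < card V" "2 * m \<le> card (V - {u, v}) + 1"
        "card (V - {u, v}) + 2 - 2 * m = k + 1" "card (V - {u, v}) + 1 - 2 * m = k"
        using card2 k assms(3) by simp_all
      ultimately show ?thesis using less(1)[OF _ c2] unfolding a_def b_def by metis
    qed
    also have "broom_sum F m a b + 2 * ((\<Sum>w\<in>V - {u}. F (graph_dist V E' u w)) + (\<Sum>w\<in>V - {u, v}. F (graph_dist V E' v w)))
        \<le> broom_sum F m (Suc a) (Suc b)"
      using le ab unfolding broom_sum_Suc_Suc by simp
    also have "Suc a = (card V + 2 - 2 * m) div 2" using k unfolding a_def by simp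
    also have "Suc b = (card V + 1 - 2 * m) div 2" using k unfolding b_def by simp
    finally show ?thesis by simp
  qed
qed

section \<open>Layered graphs\<close>

text \<open>Coordinates of a double broom: the path occupies layers \<open>1, ..., 2m - 1\<close>,
  the pendent vertices the layers 0 and \<open>2m\<close>, and exactly consecutive layers are
  joined. Outer layers may be empty, which covers paths.\<close>

definition layered :: "'a set \<Rightarrow> 'a set set \<Rightarrow> nat \<Rightarrow> nat \<Rightarrow> nat \<Rightarrow> ('a \<Rightarrow> nat) \<Rightarrow> bool" where
  "layered V E m a b pos \<longleftrightarrow> finite V \<and> 1 \<le> m \<and> (\<forall>x\<in>V. pos x \<le> 2 * m) \<and>
    (\<forall>x\<in>V. \<forall>y\<in>V. {x, y} \<in> E \<longleftrightarrow> pos x = Suc (pos y) \<or> pos y = Suc (pos x)) \<and>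
    card {x \<in> V. pos x = 0} = a \<and> card {x \<in> V. pos x = 2 * m} = b \<and>
    (\<forall>i. 0 < i \<longrightarrow> i < 2 * m \<longrightarrow> card {x \<in> V. pos x = i} = 1)"

lemma sum_distance_interval:
  "(\<Sum>i\<in>{1..<Suc N}. \<Sum>j\<in>{1..<Suc N} - {i}. F (max i j - min i j)) = path_sum F N"
proof (induction N)
  case 0 then show ?case by (simp add: path_sum_def)
next
  case (Suc N)
  have "{1..<Suc (Suc N)} - {Suc N} = {1..<Suc N}" by auto
  then have "(\<Sum>i\<in>{1..<Suc (Suc N)}. \<Sum>j\<in>{1..<Suc (Suc N)} - {i}. F (max i j - min i j)) =
     (\<Sum>i\<in>{1..<Suc N}. \<Sum>j\<in>{1..<Suc N} - {i}. F (max i j - min i j)) +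
     2 * (\<Sum>j\<in>{1..<Suc N}. F (max (Suc N) j - min (Suc N) j))"
    using double_sum_remove[of "{1..<Suc (Suc N)}" "Suc N" "\<lambda>i j. F (max i j - min i j)"]
    by (simp add: max.commute min.commute)
  also have "(\<Sum>j\<in>{1..<Suc N}. F (max (Suc N) j - min (Suc N) j)) = (\<Sum>i=1..N. F i)"
    by (rule sum.reindex_bij_witness[of _ "\<lambda>i. Suc N - i" "\<lambda>i. Suc N - i"]) auto
  finally show ?case using Suc path_sum_Suc[of F N] by simp
qed

lemma layered_props:
  assumes "layered V E m a b pos"
  shows "finite V" "1 \<le> m" "\<And>x. x \<in> V \<Longrightarrow> pos x \<le> 2 * m"
    "\<And>x y. x \<in> V \<Longrightarrow> y \<in> V \<Longrightarrow> {x, y} \<in> E \<longleftrightarrow> pos x = Suc (pos y) \<or> pos y = Suc (pos x)"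
    "card {x \<in> V. pos x = 0} = a" "card {x \<in> V. pos x = 2 * m} = b"
    "\<And>i. 0 < i \<Longrightarrow> i < 2 * m \<Longrightarrow> \<exists>!x. x \<in> V \<and> pos x = i"
proof -
  show "\<exists>!x. x \<in> V \<and> pos x = i" if "0 < i" "i < 2 * m" for i
  proof -
    have "card {x \<in> V. pos x = i} = 1" using assms that unfolding layered_def by blast
    then obtain z where "{x \<in> V. pos x = i} = {z}" using card_1_singletonE by blast
    then have "x \<in> V \<and> pos x = i \<longleftrightarrow> x = z" for x by (simp add: set_eq_iff)
    then show ?thesis by simp
  qed
qed (use assms in \<open>unfold layered_def, blast+\<close>)

lemma layered_reach:
  assumes "layered V E m a b pos" "x \<in> V" "y \<in> V" "pos x < pos y"
  shows "reach V E (pos y - pos x) x y"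
  using assms(3,4)
proof (induction "pos y - pos x" arbitrary: y)
  case (Suc k)
  note lp = layered_props[OF assms(1)]
  show ?case
  proof (cases "pos y = Suc (pos x)")
    case True
    then show ?thesis using lp(4)[OF assms(2) Suc(3)] reach_edge[of x y E V] assms(2) Suc(3) by simp
  next
    case False
    have "0 < pos y - 1" "pos y - 1 < 2 * m" using lp(3)[OF Suc(3)] Suc(4) False by auto
    then obtain z where z: "z \<in> V" "pos z = pos y - 1" using lp(7) by blast
    then have "reach V E (pos z - pos x) x z" using Suc False by (intro Suc(1)) auto
    moreover have "{z, y} \<in> E" using lp(4)[OF z(1) Suc(3)] z Suc(4) by simp
    moreover have "pos y - pos x = Suc (pos z - pos x)" using z Suc(4) False by simp
    ultimately show ?thesis using Suc(3) by (auto simp: reach_Suc)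
  qed
qed simp

text \<open>Layer numbers change by one along each edge, which bounds distances from below. Distinct
  vertices of equal layer lie in an outer layer and share its neighbouring vertex.\<close>

lemma layered_dist:
  assumes "layered V E m a b pos" "x \<in> V" "y \<in> V" "x \<noteq> y"
  shows "graph_dist V E x y = (if pos x = pos y then 2 else max (pos x) (pos y) - min (pos x) (pos y))"
proof -
  note lp = layered_props[OF assms(1)]
  have lt: "graph_dist V E x y = pos y - pos x" if "x \<in> V" "y \<in> V" "pos x < pos y" for x y
  proof -
    have r: "reach V E (pos y - pos x) x y" using layered_reach[OF assms(1) that] .
    have "pos y \<le> pos x + graph_dist V E x y"
      by (rule reach_potential_le[OF reach_dist_if[OF r]]) (use lp(4) in auto)
    then show ?thesis using dist_le_reach[OF r] by simp
  qed
  show ?thesis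
  proof (cases "pos x = pos y")
    case True
    have "\<not> (0 < pos x \<and> pos x < 2 * m)" using lp(7)[of "pos x"] assms True by auto
    then have "pos x = 0 \<or> pos x = 2 * m" using lp(3)[OF assms(2)] by auto
    moreover obtain z1 where z1: "z1 \<in> V" "pos z1 = 1" using lp(7)[of 1] lp(2) by auto
    moreover obtain z2 where z2: "z2 \<in> V" "pos z2 = 2 * m - 1" using lp(7)[of "2 * m - 1"] lp(2) by auto
    ultimately obtain z where z: "z \<in> V" "{x, z} \<in> E" "{z, y} \<in> E"
      using lp(4)[OF assms(2) z1(1)] lp(4)[OF z1(1) assms(3)] lp(4)[OF assms(2) z2(1)] lp(4)[OF z2(1) assms(3)] True lp(2) by auto
    have r: "reach V E 2 x y" using reach_trans[OF reach_edge[OF z(2) assms(2) z(1)] reach_edge[OF z(3) z(1) assms(3)]]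
      by (simp add: numeral_2_eq_2)
    note r' = reach_dist_if[OF r]
    have "\<not> reach V E 0 x y" using assms(4) by (simp add: reach_0)
    then have "graph_dist V E x y \<noteq> 0" using r' by metis
    moreover have "\<not> reach V E 1 x y"
      using lp(4)[OF assms(2,3)] True by (auto simp: reach_0 reach_Suc)
    then have "graph_dist V E x y \<noteq> 1" using r' by metis
    ultimately show ?thesis using dist_le_reach[OF r] True by simp
  next
    case False
    then show ?thesis using lt[OF assms(2,3)] lt[OF assms(3,2)] dist_sym[of V E x y]
      by (cases "pos x < pos y") (auto simp: max_def min_def)
  qed
qed

lemma layered_dist_sum:
  assumes lay: "layered V E m a b pos"
  shows "dist_sum F V E = broom_sum F m a b" "card V + 1 = a + b + 2 * m"
proof -
  note lp = layered_props[OF lay]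
  define A B S where "A = {x \<in> V. pos x = 0}" and "B = {x \<in> V. pos x = 2 * m}"
    and "S = {x \<in> V. 0 < pos x \<and> pos x < 2 * m}"
  have V: "V = S \<union> A \<union> B" using lp(3) by (force simp: A_def B_def S_def)
  have fin: "finite A" "finite B" "finite S" using lp(1) by (auto simp: A_def B_def S_def)
  have disj: "S \<inter> A = {}" "(S \<union> A) \<inter> B = {}" using lp(2) by (auto simp: A_def B_def S_def)
  have ca: "card A = a" "card B = b" using lp(5,6) by (auto simp: A_def B_def)
  have bij: "bij_betw pos S {1..<2 * m}"
  proof (rule bij_betwI')
    fix x y assume "x \<in> S" "y \<in> S"
    then show "pos x = pos y \<longleftrightarrow> x = y" using lp(7)[of "pos x"] by (auto simp: S_def)
  next
    fix i assume "i \<in> {1..<2 * m}"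
    then show "\<exists>x\<in>S. i = pos x" using lp(7)[of i] by (auto simp: S_def)
  qed (auto simp: S_def)
  have "card V = card S + a + b" unfolding V using fin disj ca by (simp add: card_Un_disjoint)
  moreover have "card S = 2 * m - 1" using bij_betw_same_card[OF bij] by simp
  ultimately show "card V + 1 = a + b + 2 * m" using lp(2) by simp
  define G where "G = (\<Sum>i\<in>{1..<2 * m}. F i)"
  have G': "(\<Sum>i\<in>{1..<2 * m}. F (2 * m - i)) = G" unfolding G_def
    by (rule sum.reindex_bij_witness[of _ "\<lambda>i. 2 * m - i" "\<lambda>i. 2 * m - i"]) auto
  let ?d = "graph_dist V E"
  note D = layered_dist[OF lay]
  have Dn: "?d x y = max (pos x) (pos y) - min (pos x) (pos y)" if "x \<in> V" "y \<in> V" "pos x \<noteq> pos y" for x y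
    using D[of x y] that by auto
  have split: "(\<Sum>y\<in>V - {x}. F (?d x y)) = (\<Sum>y\<in>S - {x}. F (?d x y)) + (\<Sum>y\<in>A - {x}. F (?d x y)) + (\<Sum>y\<in>B - {x}. F (?d x y))" for x
  proof -
    have "V - {x} = (S - {x}) \<union> (A - {x}) \<union> (B - {x})" using V by auto
    moreover have "sum g ((S - {x}) \<union> (A - {x}) \<union> (B - {x})) = sum g (S - {x}) + sum g (A - {x}) + sum g (B - {x})" for g :: "'a \<Rightarrow> real"
    proof -
      have "((S - {x}) \<union> (A - {x})) \<inter> (B - {x}) = {}" "(S - {x}) \<inter> (A - {x}) = {}" using disj by auto
      then show ?thesis using fin by (simp add: sum.union_disjoint)
    qed
    ultimately show ?thesis by simp
  qed
  have rowA: "(\<Sum>y\<in>V - {x}. F (?d x y)) = G + (real a - 1) * F 2 + real b * F (2 * m)" if x: "x \<in> A" for x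
  proof -
    have xV: "x \<in> V" "pos x = 0" using x by (auto simp: A_def)
    have "(\<Sum>y\<in>S - {x}. F (?d x y)) = (\<Sum>y\<in>S. F (pos y))"
      using xV by (intro sum.cong) (auto simp: S_def Dn)
    also have "\<dots> = G" unfolding G_def using sum.reindex_bij_betw[OF bij, of F] by simp
    finally have 1: "(\<Sum>y\<in>S - {x}. F (?d x y)) = G" .
    have "(\<Sum>y\<in>A - {x}. F (?d x y)) = (\<Sum>y\<in>A - {x}. F 2)"
      using xV D[OF xV(1)] by (intro sum.cong) (auto simp: A_def)
    also have "\<dots> = (real a - 1) * F 2"
      using card_Diff_singleton[OF x] ca(1) card_gt_0_iff[of A] x fin(1) by (auto simp: of_nat_diff Suc_le_eq)
    finally have 2: "(\<Sum>y\<in>A - {x}. F (?d x y)) = (real a - 1) * F 2" .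
    have "(\<Sum>y\<in>B - {x}. F (?d x y)) = (\<Sum>y\<in>B. F (2 * m))"
      using xV lp(2) by (intro sum.cong) (auto simp: B_def Dn)
    then show ?thesis using split[of x] 1 2 ca by simp
  qed
  have rowB: "(\<Sum>y\<in>V - {x}. F (?d x y)) = G + real a * F (2 * m) + (real b - 1) * F 2" if x: "x \<in> B" for x
  proof -
    have xV: "x \<in> V" "pos x = 2 * m" using x by (auto simp: B_def)
    have "(\<Sum>y\<in>S - {x}. F (?d x y)) = (\<Sum>y\<in>S. F (2 * m - pos y))"
      using xV by (intro sum.cong) (auto simp: S_def Dn)
    also have "\<dots> = G" using G' sum.reindex_bij_betw[OF bij, of "\<lambda>i. F (2 * m - i)"] by simp
    finally have 1: "(\<Sum>y\<in>S - {x}. F (?d x y)) = G" .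
    have "(\<Sum>y\<in>B - {x}. F (?d x y)) = (\<Sum>y\<in>B - {x}. F 2)"
      using xV D[OF xV(1)] by (intro sum.cong) (auto simp: B_def)
    also have "\<dots> = (real b - 1) * F 2"
      using card_Diff_singleton[OF x] ca(2) card_gt_0_iff[of B] x fin(2) by (auto simp: of_nat_diff Suc_le_eq)
    finally have 2: "(\<Sum>y\<in>B - {x}. F (?d x y)) = (real b - 1) * F 2" .
    have "(\<Sum>y\<in>A - {x}. F (?d x y)) = (\<Sum>y\<in>A. F (2 * m))"
      using xV lp(2) by (intro sum.cong) (auto simp: A_def Dn)
    then show ?thesis using split[of x] 1 2 ca by simp
  qed
  have rowS: "(\<Sum>y\<in>V - {x}. F (?d x y)) = (\<Sum>j\<in>{1..<2 * m} - {pos x}. F (max (pos x) j - min (pos x) j)) +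
      real a * F (pos x) + real b * F (2 * m - pos x)" if x: "x \<in> S" for x
  proof -
    have xV: "x \<in> V" "0 < pos x" "pos x < 2 * m" using x by (auto simp: S_def)
    have bij': "bij_betw pos (S - {x}) ({1..<2 * m} - {pos x})"
      using bij x by (auto simp: bij_betw_def inj_on_def)
    have "(\<Sum>y\<in>S - {x}. F (?d x y)) = (\<Sum>y\<in>S - {x}. F (max (pos x) (pos y) - min (pos x) (pos y)))"
    proof (rule sum.cong)
      fix y assume y: "y \<in> S - {x}"
      then have "pos x \<noteq> pos y" using bij x by (auto simp: bij_betw_def inj_on_def)
      then show "F (?d x y) = F (max (pos x) (pos y) - min (pos x) (pos y))"
        using D[OF xV(1), of y] y by (auto simp: S_def)
    qed simp
    also have "\<dots> = (\<Sum>j\<in>{1..<2 * m} - {pos x}. F (max (pos x) j - min (pos x) j))"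
      using sum.reindex_bij_betw[OF bij', of "\<lambda>j. F (max (pos x) j - min (pos x) j)"] by simp
    finally have 1: "(\<Sum>y\<in>S - {x}. F (?d x y)) = \<dots>" .
    have 2: "(\<Sum>y\<in>A - {x}. F (?d x y)) = (\<Sum>y\<in>A. F (pos x))"
      using xV by (intro sum.cong) (auto simp: A_def Dn)
    have "(\<Sum>y\<in>B - {x}. F (?d x y)) = (\<Sum>y\<in>B. F (2 * m - pos x))"
      using xV by (intro sum.cong) (auto simp: B_def Dn)
    then show ?thesis using split[of x] 1 2 ca by simp
  qed
  have Suc: "Suc (2 * m - 1) = 2 * m" using lp(2) by simp
  have "(\<Sum>x\<in>S. \<Sum>y\<in>V - {x}. F (?d x y)) =
    (\<Sum>x\<in>S. (\<Sum>j\<in>{1..<2 * m} - {pos x}. F (max (pos x) j - min (pos x) j)) +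
      real a * F (pos x) + real b * F (2 * m - pos x))" by (rule sum.cong[OF refl rowS])
  also have "\<dots> = (\<Sum>i\<in>{1..<2 * m}. (\<Sum>j\<in>{1..<2 * m} - {i}. F (max i j - min i j)) +
      real a * F i + real b * F (2 * m - i))"
    by (rule sum.reindex_bij_betw[OF bij])
  also have "\<dots> = path_sum F (2 * m - 1) + real a * G + real b * G"
    using sum_distance_interval[of F "2 * m - 1"] G'
    unfolding Suc by (simp add: sum.distrib sum_distrib_left[symmetric] G_def)
  finally have 3: "(\<Sum>x\<in>S. \<Sum>y\<in>V - {x}. F (?d x y)) = path_sum F (2 * m - 1) + real a * G + real b * G" .
  have "dist_sum F V E = (\<Sum>x\<in>S. \<Sum>y\<in>V - {x}. F (?d x y)) + (\<Sum>x\<in>A. \<Sum>y\<in>V - {x}. F (?d x y)) + (\<Sum>x\<in>B. \<Sum>y\<in>V - {x}. F (?d x y))"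
  proof -
    have "sum g V = sum g S + sum g A + sum g B" for g :: "'a \<Rightarrow> real"
      unfolding V using fin disj by (simp add: sum.union_disjoint)
    then show ?thesis unfolding dist_sum_def .
  qed
  also have "(\<Sum>x\<in>A. \<Sum>y\<in>V - {x}. F (?d x y)) = real a * (G + (real a - 1) * F 2 + real b * F (2 * m))"
    using ca by (simp add: rowA)
  also have "(\<Sum>x\<in>B. \<Sum>y\<in>V - {x}. F (?d x y)) = real b * (G + real a * F (2 * m) + (real b - 1) * F 2)"
    using ca by (simp add: rowB)
  finally show "dist_sum F V E = broom_sum F m a b"
    unfolding 3 broom_sum_def G_def[symmetric] by (simp add: algebra_simps)
qed

text \<open>Adjacency depends on the layers alone, so arbitrary bijections between corresponding
  layers combine to an isomorphism.\<close>

lemma layered_isomorphic: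
  assumes "layered V E m a b pos" "layered V' E' m a b pos'"
  shows "graph_isomorphic V E V' E'"
proof -
  note lp = layered_props[OF assms(1)] and lp' = layered_props[OF assms(2)]
  have "\<exists>h. bij_betw h {x \<in> V. pos x = i} {x \<in> V'. pos' x = i}" for i
  proof (rule finite_same_card_bij)
    consider "i = 0" | "i = 2 * m" | "0 < i" "i < 2 * m" | "2 * m < i" by linarith
    then show "card {x \<in> V. pos x = i} = card {x \<in> V'. pos' x = i}"
    proof cases
      case 3 then show ?thesis using assms unfolding layered_def by simp
    next
      case 4
      then have "{x \<in> V. pos x = i} = {}" "{x \<in> V'. pos' x = i} = {}" using lp(3) lp'(3) by force+
      then show ?thesis by (metis card.empty)
    qed (use lp lp' in auto)
  qed (use lp(1) lp'(1) in auto)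
  then obtain h where h: "\<And>i. bij_betw (h i) {x \<in> V. pos x = i} {x \<in> V'. pos' x = i}" by metis
  define \<phi> where "\<phi> x = h (pos x) x" for x
  have \<phi>: "\<phi> x \<in> V' \<and> pos' (\<phi> x) = pos x" if "x \<in> V" for x
    using bij_betwE[OF h[of "pos x"]] that by (auto simp: \<phi>_def)
  have "bij_betw \<phi> V V'"
  proof (rule bij_betwI')
    fix x y assume xy: "x \<in> V" "y \<in> V"
    show "\<phi> x = \<phi> y \<longleftrightarrow> x = y"
    proof
      assume eq: "\<phi> x = \<phi> y"
      then have "pos x = pos y" using \<phi>[OF xy(1)] \<phi>[OF xy(2)] by simp
      then show "x = y" using eq xy bij_betw_imp_inj_on[OF h[of "pos x"]] by (auto simp: \<phi>_def dest: inj_onD)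
    qed simp
  next
    fix y assume "y \<in> V'"
    then have "y \<in> h (pos' y) ` {x \<in> V. pos x = pos' y}"
      using bij_betw_imp_surj_on[OF h[of "pos' y"]] by auto
    then obtain x where "x \<in> V" "pos x = pos' y" "y = h (pos' y) x" by auto
    then show "\<exists>x\<in>V. y = \<phi> x" unfolding \<phi>_def by metis
  qed (use \<phi> in auto)
  moreover have "{x, y} \<in> E \<longleftrightarrow> {\<phi> x, \<phi> y} \<in> E'" if "x \<in> V" "y \<in> V" for x y
    using lp(4)[OF that] lp'(4)[of "\<phi> x" "\<phi> y"] \<phi> that by simp
  ultimately show ?thesis unfolding graph_isomorphic_def by blast
qed

lemma isomorphic_layered:
  assumes "graph_isomorphic V E V' E'" "layered V' E' m a b pos"
  obtains pos' where "layered V E m a b pos'"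
proof -
  obtain \<phi> where bij: "bij_betw \<phi> V V'" and adj: "\<forall>u\<in>V. \<forall>v\<in>V. {u, v} \<in> E \<longleftrightarrow> {\<phi> u, \<phi> v} \<in> E'"
    using assms(1) unfolding graph_isomorphic_def by blast
  have \<phi>: "\<phi> x \<in> V'" if "x \<in> V" for x using bij_betwE[OF bij] that by blast
  have card: "card {x \<in> V. pos (\<phi> x) = i} = card {x \<in> V'. pos x = i}" for i
  proof (rule bij_betw_same_card[of \<phi>])
    show "bij_betw \<phi> {x \<in> V. pos (\<phi> x) = i} {x \<in> V'. pos x = i}"
      using bij unfolding bij_betw_def inj_on_def by force
  qed
  have "finite V" using bij assms(2) bij_betw_finite unfolding layered_def by blast
  then have "layered V E m a b (\<lambda>x. pos (\<phi> x))"
    using assms(2) adj \<phi> unfolding layered_def card by auto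
  then show thesis by (rule that)
qed

lemma layered_swap:
  assumes "layered V E m a b pos"
  shows "layered V E m b a (\<lambda>x. 2 * m - pos x)"
proof -
  note lp = layered_props[OF assms]
  have "{x \<in> V. 2 * m - pos x = i} = {x \<in> V. pos x = 2 * m - i}" if "i \<le> 2 * m" for i
    using lp(3) that by force
  then have eq: "card {x \<in> V. 2 * m - pos x = i} = card {x \<in> V. pos x = 2 * m - i}" if "i \<le> 2 * m" for i
    using that by simp
  have adj: "2 * m - pos x = Suc (2 * m - pos y) \<longleftrightarrow> pos y = Suc (pos x)" if "x \<in> V" "y \<in> V" for x y
    using lp(3)[OF that(1)] lp(3)[OF that(2)] by auto
  have inner: "card {x \<in> V. pos x = i} = 1" if "0 < i" "i < 2 * m" for i
    using assms that unfolding layered_def by blast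
  show ?thesis unfolding layered_def
    using lp(1,2,4,5,6) adj eq[of 0] eq[of "2 * m"] inner[of "2 * m - _"] eq by auto
qed

text \<open>For \<open>m = 1\<close> both outer layers hang off the same centre, so pendent vertices can be moved
  freely between them.\<close>

lemma layered_star_relayer:
  assumes "layered V E 1 a b pos" "a + b = a' + b'"
  obtains pos' where "layered V E 1 a' b' pos'"
proof -
  note lp = layered_props[OF assms(1)]
  obtain z where z: "z \<in> V" "pos z = 1" "\<And>x. x \<in> V \<Longrightarrow> pos x = 1 \<Longrightarrow> x = z" using lp(7)[of 1] by auto
  have "card V + 1 = a' + b' + 2" using layered_dist_sum(2)[OF assms(1)] assms(2) by simp
  then have card: "card (V - {z}) = a' + b'" using z(1) by simp
  then obtain A where A: "A \<subseteq> V - {z}" "card A = a'" using obtain_subset_with_card_n[of a' "V - {z}"] by auto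
  have finA: "finite A" using A(1) lp(1) finite_subset by blast
  define p where "p x = (if x = z then 1 else if x \<in> A then 0 else (2::nat))" for x
  have "{x \<in> V. p x = 0} = A" using A(1) by (auto simp: p_def)
  moreover have "{x \<in> V. p x = 2} = V - {z} - A" by (auto simp: p_def)
  moreover have "card (V - {z} - A) = b'" using card_Diff_subset[OF finA A(1)] card A(2) by simp
  moreover have "{x \<in> V. p x = 1} = {z}" using z(1) by (auto simp: p_def)
  moreover have "{x, y} \<in> E \<longleftrightarrow> p x = Suc (p y) \<or> p y = Suc (p x)" if xy: "x \<in> V" "y \<in> V" for x y
  proof -
    have "pos x \<noteq> 1" if "x \<noteq> z" "x \<in> V" for x using that z(3) by blast
    then have "pos x = 0 \<or> pos x = 2" if "x \<noteq> z" "x \<in> V" for x using that lp(3)[of x] by fastforce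
    from this[of x] this[of y] show ?thesis unfolding lp(4)[OF xy] using xy z(2) by (auto simp: p_def)
  qed
  ultimately have "layered V E 1 a' b' p" unfolding layered_def using lp(1) A(2)
    by (auto simp: p_def less_2_cases_iff)
  then show thesis by (rule that)
qed

lemma nat_ceiling_half: "nat \<lceil>real s / 2\<rceil> = (s + 1) div 2"
proof -
  have "\<lceil>real s / 2\<rceil> = int ((s + 1) div 2)" by (rule ceiling_unique) linarith+
  then show ?thesis by simp
qed

lemma double_broom_layered:
  assumes "1 \<le> m" "2 * m \<le> n"
  obtains pos where "layered (double_broom_verts n m) (double_broom_edges n m) m
    ((n + 2 - 2 * m) div 2) ((n + 1 - 2 * m) div 2) pos"
proof -
  define a l where "a = (n + 2 - 2 * m) div 2" and "l = 2 * m - 1"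
  have l: "1 \<le> l" "2 * m = Suc l" using assms by (auto simp: l_def)
  have eq: "real n - 2 * real m + 1 = real (n + 1 - 2 * m)" using assms by simp
  have a: "nat \<lceil>(real n - 2 * real m + 1) / 2\<rceil> = a"
    unfolding eq nat_ceiling_half a_def using assms by (simp add: Suc_diff_le)
  have la: "l + a \<le> n" "n - (l + a) = (n + 1 - 2 * m) div 2" using assms by (auto simp: a_def l_def) 
  have edges: "double_broom_edges n m = {{i, j} | i j. i < j \<and>
         (j = Suc i \<and> j < l \<or> i = 0 \<and> l \<le> j \<and> j < l + a \<or> i = l - 1 \<and> l + a \<le> j \<and> j < n)}"
    unfolding double_broom_edges_def Let_def a l_def[symmetric] ..
  \<comment> \<open>The path is shifted up by one to free layer 0 for the vertices hanging at its
    end 0; the last layer is \<open>Suc l = 2 * m\<close>.\<close>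
  define pos where "pos j = (if j < l then Suc j else if j < l + a then 0 else Suc l)" for j
  have adj1: "{x, y} \<in> double_broom_edges n m \<longleftrightarrow> pos x = Suc (pos y) \<or> pos y = Suc (pos x)"
    if "x < y" "y < n" for x y
  proof -
    have "{x, y} \<in> double_broom_edges n m \<longleftrightarrow>
      (y = Suc x \<and> y < l \<or> x = 0 \<and> l \<le> y \<and> y < l + a \<or> x = l - 1 \<and> l + a \<le> y \<and> y < n)"
      unfolding edges using that(1) by (auto simp: doubleton_eq_iff)
    also have "\<dots> \<longleftrightarrow> pos x = Suc (pos y) \<or> pos y = Suc (pos x)"
      using that l(1) by (auto simp: pos_def)
    finally show ?thesis .
  qed
  have adj: "{x, y} \<in> double_broom_edges n m \<longleftrightarrow> pos x = Suc (pos y) \<or> pos y = Suc (pos x)"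
    if "x < n" "y < n" for x y
  proof -
    consider "x < y" | "y < x" | "x = y" by linarith
    then show ?thesis
    proof cases
      case 3
      then show ?thesis unfolding edges by (auto simp: doubleton_eq_iff)
    qed (use adj1[of x y] adj1[of y x] that in \<open>auto simp: insert_commute\<close>)
  qed
  have "{x \<in> {..<n}. pos x = 0} = {l..<l + a}" using la(1) by (auto simp: pos_def)
  moreover have "{x \<in> {..<n}. pos x = 2 * m} = {l + a..<n}" using l by (auto simp: pos_def)
  moreover have "{x \<in> {..<n}. pos x = i} = {i - 1}" if "0 < i" "i < 2 * m" for i
    using that l la(1) by (auto simp: pos_def)
  ultimately have "layered {..<n} (double_broom_edges n m) m a ((n + 1 - 2 * m) div 2) pos"
    unfolding layered_def using adj la(2) l assms(1) by (auto simp: pos_def)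
  then show thesis using that unfolding double_broom_verts_def a_def by blast
qed

section \<open>Extremal trees\<close>

lemma convex_seq_real: "convex_seq real"
  unfolding convex_seq_def by (simp add: algebra_simps)

lemma mono_on_real: "mono_on {1..} real"
  by (intro mono_onI) simp

lemma (in rooted_tree) leafI:
  assumes "z \<in> V" "z \<noteq> c" "\<And>y y'. {z, y} \<in> E \<Longrightarrow> {z, y'} \<in> E \<Longrightarrow> y = y'"
  shows "leaf z"
proof -
  have "z \<notin> par ` (V - {c})"
  proof
    assume "z \<in> par ` (V - {c})"
    then obtain x where x: "x \<in> V" "x \<noteq> c" "z = par x" by auto
    then have "{z, x} \<in> E" using par_edge[of x] by (simp add: insert_commute)
    then have "x = par z" using assms(3) par_edge[OF assms(1,2)] by blast
    then show False using depth_par[OF x(1,2)] depth_par[OF assms(1,2)] x(3) by simp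
  qed
  then show ?thesis using assms by (simp add: leaf_def)
qed

text \<open>Deleting \<open>u\<close> and \<open>v\<close> leaves at most the sum of the smaller
  broom, and the pair costs at most \<open>T\<close>; as these add up to the extremal value, the
  pair attains \<open>T\<close>. Neither leaf has to be farthest from \<open>c\<close>, so the
  result applies to many pairs.\<close>

lemma extremal_pair:
  assumes tree: "tree_graph V E" and match: "matching_le E m" and n: "2 * m + 1 \<le> card V" and m: "1 \<le> m"
    and ext: "dist_sum real V E = broom_sum real m ((card V + 2 - 2 * m) div 2) ((card V + 1 - 2 * m) div 2)"
    and cen: "centroid V E c br" and rc: "rooted_tree V E c par"
    and uv: "rooted_tree.leaf V c par u" "rooted_tree.leaf V c par v" "br u \<noteq> br v"
    and small: "\<And>t. t \<noteq> br u \<Longrightarrow> t \<noteq> br v \<Longrightarrow> 2 * card {w \<in> V - {c}. br w = t} < card V"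
    and ru: "rooted_tree V E u par'"
  shows "graph_dist V E u v = 2 * m \<and> (\<forall>w\<in>V. rooted_tree.ht V E u par' v w \<le> 1)"
proof -
  interpret rooted_tree V E c par by (rule rc)
  have n3: "3 \<le> card V" using n m by simp
  have uvV: "u \<in> V" "v \<in> V" "u \<noteq> c" "v \<noteq> c" "u \<noteq> v" using uv by (auto simp: leaf_def)
  define X where "X = int (\<Sum>w\<in>V. d u w) + int (\<Sum>w\<in>V. d v w) - int (d u v)"
  define T where "T = 2 * int m * (int (card V) - 1) + 2 * (int (card V) - 1 - 2 * int m)"
  let ?V = "V - {u, v}" and ?E = "{e \<in> E. e \<inter> {u, v} = {}}"
  have c2: "conn_graph ?V ?E" using leaves_delete uv(1,2) .
  obtain k where k: "card V = 2 * m + 1 + k" using n le_Suc_ex by blast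
  define a b where "a = (k + 1) div 2" and "b = k div 2"
  have ab': "a + b = k" unfolding a_def b_def by presburger
  have ab: "real k = real a + real b" using ab' by auto
  have eqs: "Suc a = (card V + 2 - 2 * m) div 2" "Suc b = (card V + 1 - 2 * m) div 2"
    using k unfolding a_def b_def by simp_all
  have card2: "card ?V = 2 * m + k - 1" using uvV k by (simp add: card_Diff_subset)
  have "dist_sum real ?V ?E \<le> broom_sum real m ((card ?V + 2 - 2 * m) div 2) ((card ?V + 1 - 2 * m) div 2)"
  proof (rule dist_sum_le_broom_sum[OF c2 _ m _ convex_seq_real mono_on_real])
    show "matching_le ?E m" using matching_le_subset[OF match] by auto
  qed (use card2 m in simp)
  then have le1: "dist_sum real ?V ?E \<le> broom_sum real m a b"
    using card2 m unfolding a_def b_def by simp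
  have le2: "dist_sum real V E \<le> dist_sum real ?V ?E + 2 * real_of_int X"
    using dist_sum_delete2[OF conn_graph_axioms c2 _ mono_on_real uvV(1,2,5)]
      pair_bound_real(1)[OF tree match n3 cen uvV(1-4) uv(3)] unfolding X_def by simp
  have "real_of_int T = 2 * (\<Sum>i\<in>{1..<2 * m}. real i) + (real a + real b + 1) * real (2 * m) + (real a + real b) * real 2"
    using sum_nat_interval[of "2 * m"] unfolding T_def k ab[symmetric] by (simp add: algebra_simps)
  then have "broom_sum real m (Suc a) (Suc b) = broom_sum real m a b + 2 * real_of_int T"
    unfolding broom_sum_Suc_Suc by simp
  then have "2 * real_of_int T \<le> 2 * real_of_int X"
    using ext le1 le2 unfolding eqs[symmetric] by linarith
  then have "T \<le> X" by simp
  moreover have "X \<le> T" using pair_bound(2)[OF tree match n3 cen uvV(1-4) uv(3)] unfolding X_def T_def .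
  ultimately have "X = T" by simp
  then show ?thesis
    using pair_bound(3)[OF tree match n3 cen uvV(1-4) uv(3) small _ n ru] unfolding X_def T_def by blast
qed

text \<open>\<open>x\<close> is arbitrary and \<open>y\<close> has the largest fibre apart from that
  of \<open>x\<close>. Any third fibre is disjoint from and no larger than that of \<open>y\<close>,
  hence at most half. The last claim later shows that one of the two fibres is also small.\<close>

lemma ex_dominant_fibre_pair:
  assumes "finite S" "\<And>t. \<exists>w\<in>S. br w \<noteq> t"
  obtains x y where "x \<in> S" "y \<in> S" "br x \<noteq> br y"
    "\<forall>t. t \<noteq> br x \<longrightarrow> t \<noteq> br y \<longrightarrow> 2 * card {w \<in> S. br w = t} \<le> card S"
    "card {w \<in> S. br w = br x} + card {w \<in> S. br w = br y} \<le> card S"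
proof -
  let ?k = "\<lambda>t. card {w \<in> S. br w = t}"
  have add: "?k s + ?k t \<le> card S" if "s \<noteq> t" for s t
  proof -
    have "?k s + ?k t = card ({w \<in> S. br w = s} \<union> {w \<in> S. br w = t})"
      using assms(1) that by (intro card_Un_disjoint[symmetric]) auto
    also have "\<dots> \<le> card S" by (intro card_mono assms(1)) auto
    finally show ?thesis .
  qed
  have "S \<noteq> {}" using assms(2) by blast
  obtain x where x: "x \<in> S" using \<open>S \<noteq> {}\<close> by blast
  let ?S2 = "{w \<in> S. br w \<noteq> br x}"
  have fin: "finite ((\<lambda>w. ?k (br w)) ` ?S2)" "(\<lambda>w. ?k (br w)) ` ?S2 \<noteq> {}" using assms by auto
  obtain y where y: "Max ((\<lambda>w. ?k (br w)) ` ?S2) = ?k (br y)" "y \<in> ?S2"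
    using Max_in[OF fin] by (rule imageE)
  have "2 * ?k t \<le> card S" if t: "t \<noteq> br x" "t \<noteq> br y" for t
  proof (cases "t \<in> br ` S")
    case True
    then obtain w where "w \<in> ?S2" "t = br w" using t by auto
    then have "?k t \<le> ?k (br y)" unfolding y(1)[symmetric] using Max_ge[OF fin(1)] by blast
    then show ?thesis using add[OF t(2)] by linarith
  next
    case False
    then have "{w \<in> S. br w = t} = {}" by auto
    then have "?k t = 0" by (metis card.empty)
    then show ?thesis by linarith
  qed
  then have "\<forall>t. t \<noteq> br x \<longrightarrow> t \<noteq> br y \<longrightarrow> 2 * ?k t \<le> card S" by blast
  moreover have "y \<in> S" "br x \<noteq> br y" using y(2) by auto
  ultimately show thesis using x add by (intro that)
qed

lemma extremal_path_layered:
  assumes tree: "tree_graph V E" and n: "card V = 2 * m" and m: "1 \<le> m"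
    and ext: "dist_sum real V E = path_sum real (card V)"
  shows "\<exists>a b pos. layered V E m a b pos"
proof -
  obtain u where u: "u \<in> V" "bij_betw (graph_dist V E u) V {..<card V}"
    using path_extremal_levels[OF tree ext] n m by auto
  obtain par where "rooted_tree V E u par" using tree_rooted[OF tree u(1)] .
  then interpret rooted_tree V E u par .
  have inj: "x = y" if "x \<in> V" "y \<in> V" "d u x = d u y" for x y
    using bij_betw_imp_inj_on[OF u(2)] that by (auto dest: inj_onD)
  have lt: "d u x < 2 * m" if "x \<in> V" for x using bij_betwE[OF u(2)] that n by auto
  have bwd: "{x, y} \<in> E" if "x \<in> V" "y \<in> V" "d u y = Suc (d u x)" for x y
  proof -
    have "y \<noteq> u" using that(3) dist_self[OF u(1)] by auto
    then have "par y = x" using inj[of "par y" x] par_in[OF that(2)] depth_par[OF that(2)] that by auto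
    then show ?thesis using par_edge[OF that(2) \<open>y \<noteq> u\<close>] by (simp add: insert_commute)
  qed
  have adj: "{x, y} \<in> E \<longleftrightarrow> d u x = Suc (d u y) \<or> d u y = Suc (d u x)" if "x \<in> V" "y \<in> V" for x y
  proof
    assume "{x, y} \<in> E"
    then show "d u x = Suc (d u y) \<or> d u y = Suc (d u x)" by (rule edgeE) (use depth_par in auto)
  next
    assume "d u x = Suc (d u y) \<or> d u y = Suc (d u x)"
    then show "{x, y} \<in> E" using bwd[OF that] bwd[OF that(2,1)] by (auto simp: insert_commute)
  qed
  have single: "card {x \<in> V. d u x = i} = 1" if "i < 2 * m" for i
  proof -
    have "i \<in> d u ` V" using bij_betw_imp_surj_on[OF u(2)] that n by auto
    then obtain z where "z \<in> V" "d u z = i" by auto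
    then have "{x \<in> V. d u x = i} = {z}" using inj by auto
    then show ?thesis by simp
  qed
  have "layered V E m (card {x \<in> V. d u x = 0}) (card {x \<in> V. d u x = 2 * m}) (d u)"
    unfolding layered_def using m lt adj single by (auto intro: less_imp_le)
  then show ?thesis by blast
qed

lemma extremal_tree_layered:
  assumes tree: "tree_graph V E" and match: "matching_le E m" and n: "2 * m + 1 \<le> card V" and m: "1 \<le> m"
    and ext: "dist_sum real V E = broom_sum real m ((card V + 2 - 2 * m) div 2) ((card V + 1 - 2 * m) div 2)"
  shows "\<exists>a b pos. layered V E m a b pos"
proof -
  interpret conn_graph V E using tree by (simp add: tree_graph_def)
  obtain c br where cen: "centroid V E c br" using ex_centroid[OF tree] .
  have cV: "c \<in> V" using cen by (simp add: centroid_def)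
  obtain par where rc: "rooted_tree V E c par" using tree_rooted[OF tree cV] .
  then interpret C: rooted_tree V E c par .
  have n3: "3 \<le> card V" using n m by simp
  let ?k = "\<lambda>t. card {w \<in> V - {c}. br w = t}"
  have cardV: "card (V - {c}) = card V - 1" using cV by simp
  have ex: "\<exists>w\<in>V - {c}. br w \<noteq> t" for t using C.other_branch[OF cen n3] by metis
  have fin: "finite (V - {c})" using finV by blast
  obtain x y where xy: "x \<in> V - {c}" "y \<in> V - {c}" "br x \<noteq> br y"
    "\<forall>t. t \<noteq> br x \<longrightarrow> t \<noteq> br y \<longrightarrow> 2 * ?k t \<le> card (V - {c})" "?k (br x) + ?k (br y) \<le> card (V - {c})"
    using ex_dominant_fibre_pair[OF fin ex] .
  obtain u where u: "C.leaf u" "br u = br x" using C.branch_leaf[OF cen xy(1)] .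
  obtain v where v: "C.leaf v" "br v = br y" using C.branch_leaf[OF cen xy(2)] .
  have uvV: "u \<in> V" "v \<in> V" "u \<noteq> c" "v \<noteq> c" and uv: "br u \<noteq> br v" using u v xy by (auto simp: C.leaf_def)
  have small: "2 * ?k t < card V" if "t \<noteq> br u" "t \<noteq> br v" for t
    using spec[OF xy(4), of t] that u v cardV n3 by simp
  have sum: "?k (br u) + ?k (br v) < card V" using xy(5) n3 unfolding u(2) v(2) cardV by linarith
  obtain par' where ru: "rooted_tree V E u par'" using tree_rooted[OF tree uvV(1)] .
  \<comment> \<open>Two roots are in use: leaves and branches refer to the centroid (prefix
    \<open>C\<close>), while the path to \<open>v\<close> and the heights over it refer to the root
    \<open>u\<close>.\<close>
  then interpret rooted_tree V E u par' .
  have main: "d u v = 2 * m" and ht1: "\<And>w. w \<in> V \<Longrightarrow> ht v w \<le> 1"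
    using extremal_pair[OF tree match n m ext cen rc u(1) v(1) uv small ru] by auto
  have pair2m: "d p q = 2 * m" if "C.leaf p" "C.leaf q" "br p \<noteq> br q"
    "\<And>t. t \<noteq> br p \<Longrightarrow> t \<noteq> br q \<Longrightarrow> 2 * ?k t < card V" for p q
  proof -
    have "p \<in> V" using that by (auto simp: C.leaf_def)
    then obtain par'' where "rooted_tree V E p par''" using tree_rooted[OF tree] by metis
    then show ?thesis using extremal_pair[OF tree match n m ext cen rc that(1-3)] that(4) by blast
  qed
  let ?P = "anc v"
  have cP: "c \<in> ?P"
    by (rule centroid_in_anc[of v c br]) (use uvV uv cen in \<open>auto simp: centroid_def\<close>)
  have off: "par' w \<in> ?P \<and> (d u (par' w) = 1 \<or> d u (par' w) = 2 * m - 1)" if w: "w \<in> V" "w \<notin> ?P" for w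
  proof -
    note hp = ht_par[OF uvV(2) w]
    let ?p = "par' w"
    have "ht v ?p = 0" using hp ht1[OF w(1)] by simp
    then have p: "?p \<in> ?P" "?p \<in> V" using ht_0[OF uvV(2) hp(2)] hp(2) by auto
    have dw: "d u w = Suc (d u ?p)" using depth_par[OF w(1) hp(1)] .
    \<comment> \<open>A child of \<open>w\<close> would have height 2, so \<open>w\<close> is a leaf
      and can itself enter an extremal pair.\<close>
    have nbr: "z = ?p" if "{w, z} \<in> E" for z
      using that
    proof (rule edgeE)
      assume z: "z \<in> V" "z \<noteq> u" "w = par' z"
      then have "z \<notin> ?P" using par_in_anc[OF uvV(2), of z] w(2) by auto
      then have "ht v z = Suc (ht v w)" using ht_par(3)[OF uvV(2) z(1)] z(3) by simp
      moreover have "ht v w \<noteq> 0" using ht_0[OF uvV(2) w(1)] w(2) by simp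
      ultimately show "z = ?p" using ht1[OF z(1)] by simp
    qed
    have leafw: "C.leaf w"
    proof (rule C.leafI[OF w(1)])
      show "w \<noteq> c" using cP w(2) by auto
      show "y = y'" if "{w, y} \<in> E" "{w, y'} \<in> E" for y y'
        using nbr[OF that(1)] nbr[OF that(2)] by (rule trans[OF _ sym])
    qed
    \<comment> \<open>The leaf \<open>u\<close> has one neighbour only, and that one lies on the
      path.\<close>
    have i1: "d u ?p \<noteq> 0"
    proof
      assume "d u ?p = 0"
      then have "?p = u" using depth_0[OF p(2)] by simp
      then have uw: "{u, w} \<in> E" using par_edge[OF w(1) hp(1)] by (simp add: insert_commute)
      have "1 \<in> d u ` ?P" unfolding depth_image_anc[OF uvV(2)] main using m by simp
      then obtain q where q: "q \<in> ?P" "d u q = 1" by auto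
      then have "{u, q} \<in> E" using dist_1[OF uvV(1)] anc_sub[OF uvV(2)] by auto
      then have "q = w" using C.leaf_neighbour[OF u(1)] uw by metis
      with q w show False by simp
    qed
    have wv: "d w v \<le> 1 + (2 * m - d u ?p)"
    proof -
      have "d w v \<le> d w ?p + d ?p v" using dist_triangle[OF w(1) p(2) uvV(2)] .
      moreover have "d w ?p = 1" using dist_edge[OF par_edge[OF w(1) hp(1)]] .
      moreover have "d ?p v \<le> 2 * m - d u ?p" using dist_anc[OF uvV(2) p(1)] main dist_sym[of V E v ?p] by simp
      ultimately show ?thesis by linarith
    qed
    have le2m: "d u ?p \<le> 2 * m" using anc_eqI[OF uvV(2) p(1)] main by simp
    have case1: "d u ?p = 1" if "d w v = 2 * m" using wv that i1 le2m m by linarith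
    have case2: "d u ?p = 2 * m - 1" if "d u w = 2 * m" using dw that by simp
    consider "br w = br u" | "br w = br v" | "br w \<noteq> br u" "br w \<noteq> br v" by blast
    then have "d u ?p = 1 \<or> d u ?p = 2 * m - 1"
    proof cases
      case 1
      then show ?thesis using case1[OF pair2m[OF leafw v(1)]] uv small by auto
    next
      case 2
      then show ?thesis using case2[OF pair2m[OF u(1) leafw]] uv small by auto
    next
      \<comment> \<open>The branches of \<open>u\<close> and \<open>v\<close> cannot both reach half
        of the vertices. Replacing the leaf of one with fewer than half by \<open>w\<close> keeps
        all remaining branches small.\<close>
      case 3
      show ?thesis
      proof (cases "2 * ?k (br u) < card V")
        case True
        have "2 * ?k t < card V" if "t \<noteq> br v" for t using True small that by (cases "t = br u") auto
        then show ?thesis using case1[OF pair2m[OF leafw v(1)]] 3 by auto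
      next
        case False
        then have "2 * ?k (br v) < card V" using sum by linarith
        then have "2 * ?k t < card V" if "t \<noteq> br u" for t using small that by (cases "t = br v") auto
        then show ?thesis using case2[OF pair2m[OF u(1) leafw]] 3 by auto
      qed
    qed
    with p show ?thesis by blast
  qed
  \<comment> \<open>For \<open>m = 1\<close> the positions 1 and \<open>2 * m - 1\<close> coincide
    and all vertices off the path go to layer 0; the balance is restored by relayering the
    star.\<close>
  define pos where "pos w = (if w \<in> ?P then d u w else if d u (par' w) = 1 then 0 else 2 * m)" for w
  have injP: "x = y" if "x \<in> ?P" "y \<in> ?P" "d u x = d u y" for x y
    using inj_depth_anc[OF uvV(2)] that by (auto dest: inj_onD)
  have PV: "x \<in> V" if "x \<in> ?P" for x using anc_sub[OF uvV(2)] that by auto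
  have le: "d u x \<le> 2 * m" if "x \<in> ?P" for x using anc_eqI[OF uvV(2) that] main by simp
  have uP: "u \<in> ?P" using root_in_anc[OF uvV(2)] .
  have fwd: "pos x = Suc (pos (par' x)) \<or> pos (par' x) = Suc (pos x)" if x: "x \<in> V" "x \<noteq> u" for x
  proof (cases "x \<in> ?P")
    case True
    then show ?thesis using par_in_anc[OF uvV(2) True x(2)] depth_par[OF x] by (simp add: pos_def)
  next
    case False
    then show ?thesis using off[OF x(1) False] m by (auto simp: pos_def)
  qed
  have bwd: "{x, y} \<in> E" if x: "x \<in> V" and y: "y \<in> V" and s: "pos y = Suc (pos x)" for x y
  proof -
    have "x = par' y \<and> y \<noteq> u \<or> y = par' x \<and> x \<noteq> u"
    proof (cases "y \<in> ?P")
      case True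
      then have dy: "d u y = Suc (pos x)" using s by (simp add: pos_def)
      then have yu: "y \<noteq> u" using dist_self[OF uvV(1)] by auto
      show ?thesis
      proof (cases "x \<in> ?P")
        case xP: True
        then have "d u (par' y) = d u x" using dy depth_par[OF y yu] by (simp add: pos_def)
        then show ?thesis using injP[OF xP par_in_anc[OF uvV(2) True yu]] yu by simp
      next
        case False
        then have "pos x = 0" using dy le[OF True] by (auto simp: pos_def split: if_splits)
        then have "d u (par' x) = 1" using False m by (auto simp: pos_def split: if_splits)
        then have "y = par' x" using injP[OF True, of "par' x"] off[OF x False] dy \<open>pos x = 0\<close> by simp
        then show ?thesis using False uP by auto
      qed
    next
      case False
      then have dy: "d u (par' y) = 2 * m - 1" "pos y = 2 * m"
        using off[OF y False] s by (auto simp: pos_def split: if_splits)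
      then have px: "pos x = 2 * m - 1" using s by simp
      have "x \<in> ?P" using px m by (auto simp: pos_def split: if_splits)
      then have "x = par' y" using injP[of x "par' y"] off[OF y False] px dy by (simp add: pos_def)
      then show ?thesis using False uP by auto
    qed
    then show ?thesis using par_edge[OF x] par_edge[OF y] by (auto simp: insert_commute)
  qed
  have adj: "{x, y} \<in> E \<longleftrightarrow> pos x = Suc (pos y) \<or> pos y = Suc (pos x)" if "x \<in> V" "y \<in> V" for x y
  proof
    assume "{x, y} \<in> E"
    then show "pos x = Suc (pos y) \<or> pos y = Suc (pos x)" by (rule edgeE) (use fwd in auto)
  next
    assume "pos x = Suc (pos y) \<or> pos y = Suc (pos x)"
    then show "{x, y} \<in> E" using bwd[OF that] bwd[OF that(2,1)] by (auto simp: insert_commute)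
  qed
  have single: "card {x \<in> V. pos x = i} = 1" if "0 < i" "i < 2 * m" for i
  proof -
    have "i \<in> d u ` ?P" unfolding depth_image_anc[OF uvV(2)] main using that by simp
    then obtain z where z: "z \<in> ?P" "d u z = i" by auto
    have "{x \<in> V. pos x = i} = {z}"
    proof (intro equalityI subsetI)
      fix x assume "x \<in> {x \<in> V. pos x = i}"
      then have "x \<in> ?P" "d u x = i" using that by (auto simp: pos_def split: if_splits)
      then show "x \<in> {z}" using injP[of x z] z by simp
    qed (use z PV in \<open>auto simp: pos_def\<close>)
    then show ?thesis by simp
  qed
  have "layered V E m (card {x \<in> V. pos x = 0}) (card {x \<in> V. pos x = 2 * m}) pos"
    unfolding layered_def using m adj single le by (auto simp: pos_def)
  then show ?thesis by blast
qed

section \<open>The extremal graph\<close>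

text \<open>For a fixed total the plain sum depends on the two counts only through their product,
  with coefficient \<open>4 m - 4\<close>; sum and product determine the pair. The coefficient
  vanishes for \<open>m = 1\<close>.\<close>

lemma broom_sum_real_inj:
  assumes "2 \<le> m" "a + b = a' + b'" "broom_sum real m a b = broom_sum real m a' b'"
  shows "a = a' \<and> b = b' \<or> a = b' \<and> b = a'"
proof -
  define x y x' y' where "x = real a" and "y = real b" and "x' = real a'" and "y' = real b'"
  have s: "x + y = x' + y'" using assms(2) unfolding x_def y_def x'_def y'_def by (metis of_nat_add)
  have bs: "broom_sum real m p q = path_sum real (2 * m - 1) + 2 * (real p + real q) * (\<Sum>i\<in>{1..<2 * m}. real i) +
      2 * ((real p + real q)\<^sup>2 - (real p + real q)) + (4 * real m - 4) * (real p * real q)" for p q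
    unfolding broom_sum_def by (simp add: power2_eq_square algebra_simps)
  have "(4 * real m - 4) * (x * y) = (4 * real m - 4) * (x' * y')"
    using assms(3) s unfolding bs x_def y_def x'_def y'_def by simp
  then have "x * y = x' * y'" using assms(1) by simp
  then have "(x - x') * (x - y') = 0" using s by algebra
  then have "a = a' \<or> a = b'" unfolding x_def x'_def y'_def by auto
  then show ?thesis using assms(2) by auto
qed

lemma half_sum: "(k + 1) div 2 + k div 2 = (k::nat)"
  by presburger

theorem extremal_isomorphic:
  assumes G: "conn_graph V E" and match: "matching_le E m" and m: "1 \<le> m" and n: "2 * m \<le> card V"
    and ext: "dist_sum real V E = broom_sum real m ((card V + 2 - 2 * m) div 2) ((card V + 1 - 2 * m) div 2)"
  shows "graph_isomorphic V E (double_broom_verts (card V) m) (double_broom_edges (card V) m)"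
proof -
  let ?a = "(card V + 2 - 2 * m) div 2" and ?b = "(card V + 1 - 2 * m) div 2"
  obtain E' where E': "E' \<subseteq> E" "tree_graph V E'" using ex_spanning_tree[OF G] .
  then have T: "conn_graph V E'" by (simp add: tree_graph_def)
  have ml: "matching_le E' m" using matching_le_subset match E'(1) by blast
  have "dist_sum real V E \<le> dist_sum real V E'" using dist_sum_antimono[OF T G E'(1) mono_on_real] .
  moreover have "dist_sum real V E' \<le> broom_sum real m ?a ?b"
    using dist_sum_le_broom_sum[OF T ml m _ convex_seq_real mono_on_real] n by simp
  ultimately have ext': "dist_sum real V E' = broom_sum real m ?a ?b" and "dist_sum real V E = dist_sum real V E'"
    using ext by simp_all
  then have "E = E'" using spanning_edge_set_eq[OF T G E'(1)] by simp
  have "\<exists>a b pos. layered V E m a b pos"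
  proof (cases "card V = 2 * m")
    case True
    then show ?thesis using extremal_path_layered[OF E'(2) True m] ext' broom_sum_1_0[OF m, of real] \<open>E = E'\<close> by simp
  next
    case False
    then show ?thesis using extremal_tree_layered[OF E'(2) ml _ m ext'] n \<open>E = E'\<close> by simp
  qed
  then obtain a b pos where lay: "layered V E m a b pos" by blast
  have bs: "broom_sum real m a b = broom_sum real m ?a ?b"
    using layered_dist_sum(1)[OF lay, of real] ext by simp
  obtain k where k: "card V + 1 = 2 * m + k" using n le_Suc_ex by (metis le_add1 le_trans)
  then have ab: "?a = (k + 1) div 2" "?b = k div 2" by simp_all
  have sum: "a + b = ?a + ?b" using layered_dist_sum(2)[OF lay] k half_sum[of k] unfolding ab by linarith
  have "\<exists>pos'. layered V E m ?a ?b pos'"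
  \<comment> \<open>For a star the distance sum does not see how the pendent vertices are split, but
    any split describes the same graph.\<close>
  proof (cases "m = 1")
    case True
    then show ?thesis using layered_star_relayer[of V E a b pos ?a ?b] lay sum by metis
  next
    case False
    then have "a = ?a \<and> b = ?b \<or> a = ?b \<and> b = ?a" using broom_sum_real_inj[OF _ sum bs] m by simp
    then show ?thesis using lay layered_swap[OF lay] by metis
  qed
  then obtain pos1 where 1: "layered V E m ?a ?b pos1" by blast
  obtain pos2 where "layered (double_broom_verts (card V) m) (double_broom_edges (card V) m) m ?a ?b pos2"
    using double_broom_layered[OF m n] .
  then show ?thesis by (rule layered_isomorphic[OF 1])
qed

section \<open>Matching numbers, and the passage from the function to its values at integers\<close>

lemma matching_number_props:
  assumes "simple_graph V E"
  shows "matching_le E (matching_number E)" "2 * matching_number E \<le> card V"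
    "matching_number E = 0 \<Longrightarrow> E = {}"
proof -
  have finV: "finite V" and edge: "\<And>e. e \<in> E \<Longrightarrow> e \<subseteq> V \<and> card e = 2"
    using assms by (auto simp: simple_graph_def)
  have "finite E" by (rule finite_subset[of _ "Pow V"]) (use finV edge in auto)
  moreover have "{M. graph_matching E M} \<subseteq> Pow E" by (auto simp: graph_matching_def)
  ultimately have fin: "finite {M. graph_matching E M}" using finite_Pow_iff finite_subset by metis
  have "{} \<in> {M. graph_matching E M}" by (simp add: graph_matching_def)
  then have ne: "{M. graph_matching E M} \<noteq> {}" by (metis empty_iff)
  show le: "matching_le E (matching_number E)"
    unfolding matching_le_def matching_number_def using fin by auto
  have "matching_number E \<in> card ` {M. graph_matching E M}"
    unfolding matching_number_def using fin ne by (intro Max_in) auto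
  then obtain M where M: "graph_matching E M" "card M = matching_number E" by auto
  have "card (\<Union>M) = sum card M"
    using M(1) edge finV by (intro card_Union_disjoint) (auto simp: graph_matching_def intro: finite_subset)
  also have "\<dots> = (\<Sum>e\<in>M. 2)" using M(1) edge by (intro sum.cong) (auto simp: graph_matching_def)
  finally have "card (\<Union>M) = 2 * matching_number E" using M(2) by simp
  moreover have "\<Union>M \<subseteq> V" using M(1) edge by (auto simp: graph_matching_def)
  ultimately show "2 * matching_number E \<le> card V" using card_mono[OF finV] by metis
  assume 0: "matching_number E = 0"
  show "E = {}"
  proof (rule ccontr)
    assume "E \<noteq> {}"
    then obtain e where "e \<in> E" by blast
    then have "graph_matching E {e}" by (simp add: graph_matching_def)
    then have "card {e} \<le> matching_number E" using le unfolding matching_le_def by blast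
    with 0 show False by simp
  qed
qed

lemma convex_seq_of_convex_on:
  assumes "convex_on {0..} f"
  shows "convex_seq (\<lambda>k. f (real k))"
  unfolding convex_seq_def
proof (intro allI impI)
  fix a b c :: nat assume abc: "1 \<le> a" "a \<le> b" "b \<le> c"
  show "(real c - real a) * f (real b) \<le> (real c - real b) * f (real a) + (real b - real a) * f (real c)"
  proof (cases "a = c")
    case False
    then have pos: "real c - real a > 0" using abc by simp
    define t where "t = (real b - real a) / (real c - real a)"
    have t: "0 \<le> t" "t \<le> 1" using abc pos by (auto simp: t_def)
    have tc: "t * (real c - real a) = real b - real a" using pos by (simp add: t_def)
    then have "real b = (1 - t) * real a + t * real c" by (simp add: algebra_simps)
    then have "f (real b) \<le> (1 - t) * f (real a) + t * f (real c)"
      using convex_onD[OF assms t, of "real a" "real c"] by simp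
    then have "(real c - real a) * f (real b) \<le> (real c - real a) * ((1 - t) * f (real a) + t * f (real c))"
      using pos by (intro mult_left_mono) auto
    also have "\<dots> = ((real c - real a) - t * (real c - real a)) * f (real a) + t * (real c - real a) * f (real c)"
      by (simp add: algebra_simps)
    finally show ?thesis unfolding tc by simp
  qed (use abc in simp)
qed

lemma mono_on_of_step:
  fixes g :: "nat \<Rightarrow> real"
  assumes "\<And>k. 1 \<le> k \<Longrightarrow> g k \<le> g (Suc k)"
  shows "mono_on {1..} g"
proof (rule mono_onI)
  fix r s :: nat assume "r \<in> {1..}" "s \<in> {1..}" "r \<le> s"
  from this(3,1) show "g r \<le> g s"
    by (induction s rule: dec_induct) (auto intro: order_trans[OF _ assms])
qed

text \<open>No increment of a convex sequence is below its first one, \<open>F 2 - F 1\<close>;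
  removing this slope leaves nonnegative increments. The first of them is 0, so only weak
  monotonicity remains.\<close>

lemma convex_seq_remainder:
  assumes "convex_seq F"
  defines "g \<equiv> \<lambda>k. F k - (F 2 - F 1) * real k"
  shows "convex_seq g" "mono_on {1..} g"
proof -
  have cv: "(real c - real a) * F b \<le> (real c - real b) * F a + (real b - real a) * F c"
    if "1 \<le> a" "a \<le> b" "b \<le> c" for a b c using assms(1) that unfolding convex_seq_def by blast
  define s where "s = F 2 - F 1"
  show "convex_seq g" unfolding convex_seq_def g_def s_def[symmetric]
  proof (intro allI impI)
    fix a b c :: nat assume "1 \<le> a" "a \<le> b" "b \<le> c"
    from cv[OF this] show "(real c - real a) * (F b - s * real b)
       \<le> (real c - real b) * (F a - s * real a) + (real b - real a) * (F c - s * real c)"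
      by (simp add: algebra_simps)
  qed
  show "mono_on {1..} g"
  proof (rule mono_on_of_step)
    fix k :: nat assume k: "1 \<le> k"
    show "g k \<le> g (Suc k)"
    proof (cases "k = 1")
      case True
      then show ?thesis by (simp add: g_def numeral_2_eq_2 algebra_simps)
    next
      case False
      then have pos: "real k - 1 > 0" using k by simp
      \<comment> \<open>Convexity at \<open>1, 2, k\<close> and at \<open>1, k, k + 1\<close>; the
        sum of both inequalities is \<open>k - 1\<close> times the comparison of increments.\<close>
      have "(real k - 1) * F 2 \<le> (real k - 2) * F 1 + F k" using cv[of 1 2 k] k False by simp
      moreover have "real k * F k \<le> F 1 + (real k - 1) * F (Suc k)" using cv[of 1 k "Suc k"] k by simp
      ultimately have "(real k - 1) * (F k + s) \<le> (real k - 1) * F (Suc k)"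
        unfolding s_def by (simp add: algebra_simps)
      then have "F k + s \<le> F (Suc k)" using pos by (simp only: mult_le_cancel_left_pos)
      then show ?thesis unfolding g_def s_def[symmetric] by (simp add: algebra_simps)
    qed
  qed
qed

lemma wiener_f_split:
  assumes "\<And>k. f (real k) = s * real k + g k"
  shows "wiener_f f V E = (s * dist_sum real V E + dist_sum g V E) / 2"
  unfolding wiener_f_def dist_sum_def assms by (simp add: sum.distrib sum_distrib_left)

theorem theorem6:
  fixes f :: "real \<Rightarrow> real" and V :: "'a set" and E :: "'a set set" and n m :: nat
  assumes "convex_on {0..} f" and "f 0 = 0" and "strict_mono_on {0<..} f"
    and "simple_graph V E" and "connected_graph V E"
    and "card V = n" and "matching_number E = m"
  shows "wiener_f f V E \<le> wiener_f f (double_broom_verts n m) (double_broom_edges n m) \<and>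
    (wiener_f f V E = wiener_f f (double_broom_verts n m) (double_broom_edges n m) \<longleftrightarrow>
     graph_isomorphic V E (double_broom_verts n m) (double_broom_edges n m))"
proof (cases "m = 0")
  \<comment> \<open>Without edges, connectedness leaves a single vertex, and the double broom
    degenerates to the same graph.\<close>
  case True
  then have E: "E = {}" using matching_number_props(3)[OF assms(4)] assms(7) by simp
  obtain x where x: "x \<in> V" using assms(5) by (auto simp: connected_graph_def)
  have "y = x" if y: "y \<in> V" for y
  proof -
    obtain k where "reach V E k x y" using assms(5) x y unfolding connected_graph_iff_reach by blast
    then show ?thesis using E by (cases k) (auto simp: reach_0 reach_Suc)
  qed
  then have V: "V = {x}" using x by blast
  have "double_broom_edges n m = {}" "double_broom_verts n m = {0}"
    using V assms(6) True by (auto simp: double_broom_edges_def double_broom_verts_def Let_def)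
  then show ?thesis using V E
    by (auto simp: wiener_f_def graph_isomorphic_def intro!: exI[of _ "\<lambda>_. 0"] bij_betwI')
next
  case False
  then have m: "1 \<le> m" by simp
  have G: "conn_graph V E" using assms by unfold_locales
  have match: "matching_le E m" and n: "2 * m \<le> card V" using matching_number_props[OF assms(4)] assms(7) by auto
  let ?B = "double_broom_verts n m" and ?BE = "double_broom_edges n m"
  define a b where "a = (card V + 2 - 2 * m) div 2" and "b = (card V + 1 - 2 * m) div 2"
  obtain pos where lay: "layered ?B ?BE m a b pos"
    using double_broom_layered[OF m n] unfolding a_def b_def assms(6) by blast
  define F where "F k = f (real k)" for k
  define s where "s = F 2 - F 1"
  define g where "g k = F k - s * real k" for k
  \<comment> \<open>The strict increase of \<open>f\<close> makes the linear part genuinely present,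
    so that equality for \<open>f\<close> passes to plain distances.\<close>
  have "0 < s" using strict_mono_onD[OF assms(3), of 1 2] by (simp add: s_def F_def)
  have cF: "convex_seq F" using convex_seq_of_convex_on[OF assms(1)] unfolding F_def .
  have cg: "convex_seq g" "mono_on {1..} g" using convex_seq_remainder[OF cF] unfolding g_def s_def .
  have "f (real k) = s * real k + g k" for k by (simp add: g_def F_def)
  note W = wiener_f_split[OF this]
  note bound = dist_sum_le_broom_sum[OF G match m, folded a_def b_def]
  have le_real: "dist_sum real V E \<le> dist_sum real ?B ?BE"
    using bound[OF _ convex_seq_real mono_on_real] n layered_dist_sum(1)[OF lay] by simp
  have le_g: "dist_sum g V E \<le> dist_sum g ?B ?BE"
    using bound[OF _ cg] n layered_dist_sum(1)[OF lay] by simp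
  have le_s: "s * dist_sum real V E \<le> s * dist_sum real ?B ?BE" using le_real \<open>0 < s\<close> by simp
  have "wiener_f f V E \<le> wiener_f f ?B ?BE" unfolding W using le_s le_g by simp
  moreover have "graph_isomorphic V E ?B ?BE" if "wiener_f f V E = wiener_f f ?B ?BE"
  proof -
    have "s * dist_sum real V E + dist_sum g V E = s * dist_sum real ?B ?BE + dist_sum g ?B ?BE"
      using that unfolding W by simp
    then have "s * dist_sum real V E = s * dist_sum real ?B ?BE" using le_s le_g by linarith
    then have "dist_sum real V E = broom_sum real m a b" using \<open>0 < s\<close> layered_dist_sum(1)[OF lay] by simp
    then show ?thesis using extremal_isomorphic[OF G match m n] unfolding a_def b_def assms(6) by simp
  qed
  moreover have "wiener_f f V E = wiener_f f ?B ?BE" if iso: "graph_isomorphic V E ?B ?BE"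
  proof -
    obtain pos' where "layered V E m a b pos'" using isomorphic_layered[OF iso lay] .
    then show ?thesis unfolding W by (simp add: layered_dist_sum(1) layered_dist_sum(1)[OF lay])
  qed
  ultimately show ?thesis by blast
qed

end
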